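(* Let $\Omega\subseteq\mathbb{H}$ be a symmetric slice domain, and let $f:\Omega\to\mathbb{H}$ be an injective regular function. Let $\mathbb{J}^f=f_*\,\mathbb{J}\,(f_* )^{-1}$ be the induced structure on $f(\Omega\setminus\mathbb{R})$. Then $$\mathbb{J}^f_{f(q)}\mathbf{v}=I_q\mathbf{v}$$ for all $q\in\Omega\setminus\mathbb{R}$ and $\mathbf{v}\in T_{f(q)}f(\Omega\setminus\mathbb{R})\cong\mathbb{H}$. As a consequence, $\mathbb{J}^f$ is an orthogonal complex structure on $f(\Omega\setminus\mathbb{R})$.
   Context: $\mathbb{H}$ denotes the quaternions ($\cong\mathbb{R}^4$ with the Euclidean metric and the orientation of $1,i,j,k$), $\mathbb{S}=\{q\in\mathbb{H}:q^2=-1\}$, $L_I=\mathbb{R}+I\mathbb{R}$ for $I\in\mathbb{S}$. All tangent spaces of open subsets of $\mathbb{H}$ are identified with $\mathbb{H}$. A symmetric slice domain is a domain $\Omega\subseteq\mathbb{H}$ such that $\Omega\cap\mathbb{R}\ne\emptyset$, $\Omega_I=\Omega\cap L_I$ is open and connected in $L_I$ for every $I\in\mathbb{S}$, and $\Omega$ is axially symmetric with respect to $\mathbb{R}$ (i.e. $x+yI\in\Omega$ for some $I\in\mathbb{S}$ implies $x+yI'\in\Omega$ for all $I'\in\mathbb{S}$). A function $f:\Omega\to\mathbb{H}$ is (slice) regular if for all $I\in\mathbb{S}$ the restriction $f_I=f|_{\Omega_I}$ satisfies $\frac12\left(\frac{\partial}{\partial x}+I\frac{\partial}{\partial y}\right)f_I(x+Iy)=0$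 on $\Omega_I$. The real differential $f_*$ of an injective regular function on a symmetric slice domain is invertible at every point. For $q\in\mathbb{H}\setminus\mathbb{R}$ let $I_q=\mathrm{Im}(q)/|\mathrm{Im}(q)|\in\mathbb{S}$; the complex structure $\mathbb{J}$ on $\mathbb{H}\setminus\mathbb{R}$ is $\mathbb{J}_q\mathbf{v}=I_q\mathbf{v}$ (quaternionic left multiplication). An orthogonal complex structure (OCS) on an oriented Riemannian 4-manifold $(M,g)$ is an endomorphism $J:TM\to TM$ with $J^2=-\mathrm{id}$, $g(J\mathbf{v},J\mathbf{w})=g(\mathbf{v},\mathbf{w})$, compatible with the orientation of $M$, and integrable. *)

theory Defs
  imports "HOL-Analysis.Analysis"
begin

section \<open>The quaternions\<close>

codatatype quat = Quat (qRe: real) (qI: real) (qJ: real) (qK: real)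

lemma quat_eq_iff: "p = q \<longleftrightarrow> qRe p = qRe q \<and> qI p = qI q \<and> qJ p = qJ q \<and> qK p = qK q"
  by (auto intro: quat.expand)

instantiation quat :: ab_group_add
begin

primcorec zero_quat where
  "qRe 0 = 0" | "qI 0 = 0" | "qJ 0 = 0" | "qK 0 = 0"

primcorec plus_quat where
  "qRe (p + q) = qRe p + qRe q"
| "qI (p + q) = qI p + qI q"
| "qJ (p + q) = qJ p + qJ q"
| "qK (p + q) = qK p + qK q"

primcorec uminus_quat where
  "qRe (- p) = - qRe p"
| "qI (- p) = - qI p"
| "qJ (- p) = - qJ p"
| "qK (- p) = - qK p"

primcorec minus_quat where
  "qRe (p - q) = qRe p - qRe q"
| "qI (p - q) = qI p - qI q"
| "qJ (p - q) = qJ p - qJ q"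
| "qK (p - q) = qK p - qK q"

instance
  by standard (simp_all add: quat_eq_iff)

end

instantiation quat :: ring_1
begin

primcorec one_quat where
  "qRe 1 = 1" | "qI 1 = 0" | "qJ 1 = 0" | "qK 1 = 0"

primcorec times_quat where
  "qRe (p * q) = qRe p * qRe q - qI p * qI q - qJ p * qJ q - qK p * qK q"
| "qI (p * q) = qRe p * qI q + qI p * qRe q + qJ p * qK q - qK p * qJ q"
| "qJ (p * q) = qRe p * qJ q - qI p * qK q + qJ p * qRe q + qK p * qI q"
| "qK (p * q) = qRe p * qK q + qI p * qJ q - qJ p * qI q + qK p * qRe q"

instance
  by standard (simp_all add: quat_eq_iff algebra_simps)

end

instantiation quat :: real_algebra_1
begin

primcorec scaleR_quat where
  "qRe (r *\<^sub>R q) = r * qRe q"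
| "qI (r *\<^sub>R q) = r * qI q"
| "qJ (r *\<^sub>R q) = r * qJ q"
| "qK (r *\<^sub>R q) = r * qK q"

instance
  by standard (simp_all add: quat_eq_iff algebra_simps)

end

lemma quat_sum_squares_eq_0_iff:
  "(qRe q)\<^sup>2 + (qI q)\<^sup>2 + (qJ q)\<^sup>2 + (qK q)\<^sup>2 = 0 \<longleftrightarrow> q = 0"
  by (simp add: add_nonneg_eq_0_iff quat_eq_iff)

instantiation quat :: division_ring
begin

definition inverse_quat :: "quat \<Rightarrow> quat" where
  "inverse q = inverse ((qRe q)\<^sup>2 + (qI q)\<^sup>2 + (qJ q)\<^sup>2 + (qK q)\<^sup>2) *\<^sub>R
     Quat (qRe q) (- qI q) (- qJ q) (- qK q)"

definition divide_quat :: "quat \<Rightarrow> quat \<Rightarrow> quat" where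
  "divide_quat p q = p * inverse q"

instance
proof
  fix p q :: quat
  show "inverse (0::quat) = 0"
    by (simp add: inverse_quat_def)
  show "p div q = p * inverse q"
    by (simp add: divide_quat_def)
  assume "q \<noteq> 0"
  let ?n = "(qRe q)\<^sup>2 + (qI q)\<^sup>2 + (qJ q)\<^sup>2 + (qK q)\<^sup>2"
  let ?c = "Quat (qRe q) (- qI q) (- qJ q) (- qK q)"
  have n: "?n \<noteq> 0"
    using \<open>q \<noteq> 0\<close> quat_sum_squares_eq_0_iff by blast
  have "?c * q = ?n *\<^sub>R 1" "q * ?c = ?n *\<^sub>R 1"
    by (simp_all add: quat_eq_iff power2_eq_square algebra_simps)
  then show "inverse q * q = 1" "q * inverse q = 1"
    using n by (simp_all add: inverse_quat_def)
qed

end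

instance quat :: real_div_algebra ..

instantiation quat :: real_inner
begin

definition inner_quat :: "quat \<Rightarrow> quat \<Rightarrow> real" where
  "inner p q = qRe p * qRe q + qI p * qI q + qJ p * qJ q + qK p * qK q"

definition norm_quat :: "quat \<Rightarrow> real" where
  "norm_quat q = sqrt (inner q q)"

definition sgn_quat :: "quat \<Rightarrow> quat" where
  "sgn_quat q = q /\<^sub>R norm q"

definition dist_quat :: "quat \<Rightarrow> quat \<Rightarrow> real" where
  "dist_quat p q = norm (p - q)"

definition uniformity_quat :: "(quat \<times> quat) filter" where
  "uniformity_quat = (INF e\<in>{0<..}. principal {(x, y). dist x y < e})"

definition open_quat :: "quat set \<Rightarrow> bool" where
  "open_quat U \<longleftrightarrow> (\<forall>x\<in>U. eventually (\<lambda>(x', y). x' = x \<longrightarrow> y \<in> U) uniformity)"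

instance
proof
  fix x y z :: quat and r :: real
  show "dist x y = norm (x - y)"
    by (simp add: dist_quat_def)
  show "sgn x = x /\<^sub>R norm x"
    by (simp add: sgn_quat_def)
  show "(uniformity :: (quat \<times> quat) filter) = (INF e\<in>{0<..}. principal {(x, y). dist x y < e})"
    by (rule uniformity_quat_def)
  show "open U \<longleftrightarrow> (\<forall>x\<in>U. eventually (\<lambda>(x', y). x' = x \<longrightarrow> y \<in> U) uniformity)" for U :: "quat set"
    by (rule open_quat_def)
  show "inner x y = inner y x" "inner (x + y) z = inner x z + inner y z"
    "inner (r *\<^sub>R x) y = r * inner x y" "0 \<le> inner x x"
    by (simp_all add: inner_quat_def algebra_simps)
  show "inner x x = 0 \<longleftrightarrow> x = 0"
    using quat_sum_squares_eq_0_iff[of x] by (simp add: inner_quat_def power2_eq_square)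
  show "norm x = sqrt (inner x x)"
    by (simp add: norm_quat_def)
qed

end

instance quat :: real_normed_div_algebra
proof
  fix x y :: quat
  have "inner (x * y) (x * y) = inner x x * inner y y"
    unfolding inner_quat_def times_quat.sel by algebra
  then show "norm (x * y) = norm x * norm y"
    by (simp add: norm_quat_def real_sqrt_mult)
qed

instantiation quat :: euclidean_space
begin

definition Basis_quat :: "quat set" where
  "Basis_quat = {Quat 1 0 0 0, Quat 0 1 0 0, Quat 0 0 1 0, Quat 0 0 0 1}"

instance
proof
  show "(Basis :: quat set) \<noteq> {}" "finite (Basis :: quat set)"
    by (simp_all add: Basis_quat_def)
  show "inner u v = (if u = v then 1 else 0)" if "u \<in> Basis" "v \<in> Basis" for u v :: quat
    using that unfolding Basis_quat_def by (elim insertE emptyE) (simp_all add: inner_quat_def)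
  show "(\<forall>u\<in>Basis. inner x u = 0) \<longleftrightarrow> x = 0" for x :: quat
    by (simp add: Basis_quat_def inner_quat_def quat_eq_iff[of x])
qed

end

text \<open>The orientation of \<open>\<real>\<^sup>4\<close> for which \<open>1, i, j, k\<close> is a positive basis.\<close>

definition quat_coords :: "quat \<Rightarrow> real^4" where
  "quat_coords q = vector [qRe q, qI q, qJ q, qK q]"

definition positively_oriented :: "quat \<Rightarrow> quat \<Rightarrow> quat \<Rightarrow> quat \<Rightarrow> bool" where
  "positively_oriented a b c d \<longleftrightarrow>
     0 < det (vector [quat_coords a, quat_coords b, quat_coords c, quat_coords d] :: real^4^4)"


section \<open>Slices, symmetric slice domains, slice regular functions\<close>

text \<open>The real axis is \<^term>\<open>\<real> :: quat set\<close>, the range of \<^term>\<open>of_real :: real \<Rightarrow> quat\<close>.\<close>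

definition unit_imag :: "quat set" where
  "unit_imag = {q. q\<^sup>2 = - 1}"

definition slice_pt :: "quat \<Rightarrow> real \<Rightarrow> real \<Rightarrow> quat" where
  "slice_pt I x y = of_real x + y *\<^sub>R I"

definition slice :: "quat \<Rightarrow> quat set" where
  "slice I = {slice_pt I x y | x y. True}"

definition axially_symmetric :: "quat set \<Rightarrow> bool" where
  "axially_symmetric \<Omega> \<longleftrightarrow>
     (\<forall>x y. \<forall>I\<in>unit_imag. \<forall>I'\<in>unit_imag. slice_pt I x y \<in> \<Omega> \<longrightarrow> slice_pt I' x y \<in> \<Omega>)"

definition symmetric_slice_domain :: "quat set \<Rightarrow> bool" where
  "symmetric_slice_domain \<Omega> \<longleftrightarrow>
     open \<Omega> \<and> connected \<Omega> \<and> \<Omega> \<inter> \<real> \<noteq> {} \<and>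
     (\<forall>I\<in>unit_imag. openin (top_of_set (slice I)) (\<Omega> \<inter> slice I) \<and> connected (\<Omega> \<inter> slice I)) \<and>
     axially_symmetric \<Omega>"

text \<open>Regularity is a condition on each restriction \<open>f\<^sub>I\<close>, viewed as a function of the two real
  variables \<open>(x, y)\<close>: it is real differentiable and satisfies the Cauchy--Riemann equation.
  Nothing is assumed about the joint behaviour of \<open>f\<close> across different slices.\<close>

definition slice_regular_on :: "(quat \<Rightarrow> quat) \<Rightarrow> quat set \<Rightarrow> bool" where
  "slice_regular_on f \<Omega> \<longleftrightarrow>
     (\<forall>I\<in>unit_imag. \<forall>x y. slice_pt I x y \<in> \<Omega> \<longrightarrow>
        (\<lambda>(s, t). f (slice_pt I s t)) differentiable (at (x, y)) \<and>
        (1/2) *\<^sub>R (vector_derivative (\<lambda>s. f (slice_pt I s y)) (at x) +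
                  I * vector_derivative (\<lambda>t. f (slice_pt I x t)) (at y)) = 0)"


section \<open>The complex structure off the real axis and its push-forward\<close>

definition quat_Im :: "quat \<Rightarrow> quat" where
  "quat_Im q = q - of_real (qRe q)"

definition imag_dir :: "quat \<Rightarrow> quat" where
  "imag_dir q = quat_Im q /\<^sub>R norm (quat_Im q)"

text \<open>A field of endomorphisms of the tangent spaces of an open set of quaternions is given as
  \<open>J :: quat \<Rightarrow> quat \<Rightarrow> quat\<close>, with \<open>J p\<close> acting on the tangent space at \<open>p\<close>, identified with
  the type \<^typ>\<open>quat\<close>.\<close>

definition slice_structure :: "quat \<Rightarrow> quat \<Rightarrow> quat" where
  "slice_structure q v = imag_dir q * v"

text \<open>The push-forward \<open>f\<^sub>* J (f\<^sub>*)\<^sup>-\<^sup>1\<close> is meaningful at points of \<open>f ` U\<close>, when \<open>f\<close> is injective on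
  the open set \<open>U\<close> and has bijective differential at every point of \<open>U\<close>.\<close>

definition push_forward ::
    "(quat \<Rightarrow> quat) \<Rightarrow> quat set \<Rightarrow> (quat \<Rightarrow> quat \<Rightarrow> quat) \<Rightarrow> quat \<Rightarrow> quat \<Rightarrow> quat" where
  "push_forward f U J p v =
     (let q = inv_into U f p; D = frechet_derivative f (at q) in D (J q (inv D v)))"


section \<open>Orthogonal complex structures\<close>

text \<open>\<open>C_k_on k f U\<close>: \<open>f\<close> is \<open>k\<close> times continuously differentiable on the open set \<open>U\<close>. In finite
  dimensions continuity of the derivative may be tested on each direction \<open>v\<close> separately.\<close>

primrec C_k_on :: "nat \<Rightarrow> ('a::euclidean_space \<Rightarrow> 'b::euclidean_space) \<Rightarrow> 'a set \<Rightarrow> bool" where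
  "C_k_on 0 f U \<longleftrightarrow> continuous_on U f"
| "C_k_on (Suc k) f U \<longleftrightarrow>
     (\<forall>x\<in>U. f differentiable (at x)) \<and> (\<forall>v. C_k_on k (\<lambda>x. frechet_derivative f (at x) v) U)"

definition smooth_map_on :: "('a::euclidean_space \<Rightarrow> 'b::euclidean_space) \<Rightarrow> 'a set \<Rightarrow> bool" where
  "smooth_map_on f U \<longleftrightarrow> (\<forall>k. C_k_on k f U)"

text \<open>\<open>J\<close> is integrable if around each point there is a smooth coordinate chart with values in
  \<open>\<complex>\<^sup>2\<close> whose differential carries \<open>J\<close> to multiplication by \<open>\<i>\<close>, i.e. if \<open>J\<close> is induced by
  a holomorphic atlas. In particular \<open>J\<close> is then automatically smooth.\<close>

definition integrable_structure :: "quat set \<Rightarrow> (quat \<Rightarrow> quat \<Rightarrow> quat) \<Rightarrow> bool" where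
  "integrable_structure M J \<longleftrightarrow>
     (\<forall>p\<in>M. \<exists>V W. \<exists>\<phi> :: quat \<Rightarrow> complex^2. \<exists>\<psi>.
        open V \<and> p \<in> V \<and> V \<subseteq> M \<and> open W \<and>
        homeomorphism V W \<phi> \<psi> \<and> smooth_map_on \<phi> V \<and> smooth_map_on \<psi> W \<and>
        (\<forall>q\<in>V. \<forall>v. frechet_derivative \<phi> (at q) (J q v) = \<i> *s frechet_derivative \<phi> (at q) v))"

text \<open>The manifold is an open set of quaternions, with the Euclidean metric and the orientation
  above. Compatibility with the orientation means that every basis of the form
  \<open>v, J v, w, J w\<close> is positively oriented.\<close>

definition orthogonal_complex_structure_on :: "quat set \<Rightarrow> (quat \<Rightarrow> quat \<Rightarrow> quat) \<Rightarrow> bool" where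
  "orthogonal_complex_structure_on M J \<longleftrightarrow>
     open M \<and>
     (\<forall>p\<in>M. linear (J p) \<and>
        (\<forall>v. J p (J p v) = - v) \<and>
        (\<forall>v w. J p v \<bullet> J p w = v \<bullet> w) \<and>
        (\<forall>v w. v \<noteq> 0 \<and> w \<notin> span {v, J p v} \<longrightarrow> positively_oriented v (J p v) w (J p w))) \<and>
     integrable_structure M J"

end

theory Submission
  imports Defs "HOL-Complex_Analysis.Conformal_Mappings"
begin

text \<open>The representation formula says \<open>f (x + yI) = b + I c\<close>, where \<open>b\<close>, \<open>c\<close> depend only on
  \<open>z = x + \<i>y\<close> and \<open>b + \<i> c\<close> is holomorphic. Hence off the real axis the differential of \<open>f\<close> at
  \<open>x + yI\<close> sends \<open>u + w\<close>, with \<open>u\<close> in the slice of \<open>I\<close> and \<open>w\<close> orthogonal to it, to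
  \<open>u A + w C\<close> with \<open>A = \<partial>\<^sub>x b + I \<partial>\<^sub>x c\<close> and \<open>C = c / y\<close>. As both summands of the domain are
  preserved by left multiplication with \<open>I\<close>, the differential commutes with it, which gives the
  formula for the induced structure. Left multiplication by a unit imaginary quaternion is
  orthogonal and compatible with the orientation, and the induced structure is integrable because
  \<open>f\<close>, a diffeomorphism onto its image, transports the charts
  \<open>q \<mapsto> (z, stereographic projection of I)\<close>. The invertibility of the differential follows from injectivity by
  a perturbation argument for zeros of holomorphic functions.\<close>


section \<open>Calculus of \<open>C\<^sup>k\<close> maps\<close>

text \<open>Regularity gives differentiability inside each slice only, and different slices meet
  just in the real axis; without the representation formula nothing is known in directions
  orthogonal to a slice. The second obstacle is invertibility of the differential: the push-forward
  applies \<open>inv\<close> to it, and the charts need a differentiable inverse of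
  \<open>f\<close>. Where \<open>C\<close> is nonzero, the differential is singular exactly when
  \<open>A\<close> is orthogonal to \<open>C\<close> and to \<open>I * C\<close>. To contradict
  injectivity in that case, the value of \<open>f\<close> is displaced by \<open>t\<close> times a
  fixed quaternion. The displaced value must be a genuine quaternion, so a complex solution
  \<open>t\<close> is useless, and one real \<open>t\<close> has to be produced at two different
  points. It exists because near a multiple zero a holomorphic function is either constant or the
  n-th power, n at least two, of a local coordinate, and a small positive number has several n-th
  roots.\<close>

lemma frechet_derivative_cong_open:
  assumes "open U" "x \<in> U" "\<And>y. y \<in> U \<Longrightarrow> f y = g y"
  shows "frechet_derivative f (at x) = frechet_derivative g (at x)"
proof -
  \<comment> \<open>\<open>frechet_derivative\<close> is a choice from the set of derivatives at
    \<open>x\<close>, and that set depends only on the function near \<open>x\<close>.\<close>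
  have "(f has_derivative D) (at x) \<longleftrightarrow> (g has_derivative D) (at x)" for D
    using has_derivative_transform_within_open[OF _ assms(1,2), of f D UNIV g]
      has_derivative_transform_within_open[OF _ assms(1,2), of g D UNIV f] assms(3)
    by auto
  then show ?thesis
    by (simp add: frechet_derivative_def)
qed

lemma C_k_on_cong:
  assumes "open U" "\<And>x. x \<in> U \<Longrightarrow> f x = g x"
  shows "C_k_on k f U \<longleftrightarrow> C_k_on k g U"
  using assms(2)
proof (induction k arbitrary: f g)
  case 0
  then show ?case by (auto intro: continuous_on_cong)
next
  case (Suc k)
  have "f differentiable (at x) \<longleftrightarrow> g differentiable (at x)" if "x \<in> U" for x
    using has_derivative_transform_within_open[OF _ assms(1) that, of f _ UNIV g]
      has_derivative_transform_within_open[OF _ assms(1) that, of g _ UNIV f] Suc.prems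
    by (auto simp: differentiable_def)
  moreover have "C_k_on k (\<lambda>x. frechet_derivative f (at x) v) U \<longleftrightarrow>
      C_k_on k (\<lambda>x. frechet_derivative g (at x) v) U" for v
    by (rule Suc.IH) (metis frechet_derivative_cong_open[OF assms(1)] Suc.prems)
  ultimately show ?case by simp
qed

text \<open>Lets an explicit formula stand in for the derivative picked by choice; most closure
  rules below go through this rule.\<close>

lemma C_k_on_SucI:
  assumes "open U" "\<And>x. x \<in> U \<Longrightarrow> (f has_derivative f' x) (at x)"
    and "\<And>v. C_k_on k (\<lambda>x. f' x v) U"
  shows "C_k_on (Suc k) f U"
proof -
  have "C_k_on k (\<lambda>x. frechet_derivative f (at x) v) U \<longleftrightarrow> C_k_on k (\<lambda>x. f' x v) U" for v
    by (rule C_k_on_cong[OF assms(1)]) (simp add: frechet_derivative_at[OF assms(2), symmetric])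
  then show ?thesis
    using assms(2,3) by (auto simp: differentiable_def)
qed

lemma C_k_on_SucD:
  assumes "C_k_on (Suc k) f U" "x \<in> U"
  shows "(f has_derivative frechet_derivative f (at x)) (at x)"
  using assms by (simp add: frechet_derivative_works)

lemma C_k_on_Suc_imp: "C_k_on (Suc k) f U \<Longrightarrow> C_k_on k f U"
proof (induction k arbitrary: f)
  case 0
  then show ?case
    by (auto intro!: continuous_at_imp_continuous_on differentiable_imp_continuous_within)
next
  case (Suc k)
  then show ?case
    using C_k_on.simps(2) by blast
qed

lemma C_k_on_subset: "C_k_on k f U \<Longrightarrow> V \<subseteq> U \<Longrightarrow> C_k_on k f V"
  by (induction k arbitrary: f) (auto intro: continuous_on_subset)

lemma C_k_on_const [simp]: "C_k_on k (\<lambda>x. c) U"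
proof (induction k arbitrary: c)
  case (Suc k)
  then show ?case by (simp add: frechet_derivative_const)
qed simp

lemma C_k_on_linear:
  assumes "bounded_linear f"
  shows "C_k_on k f U"
proof (cases k)
  case 0
  then show ?thesis using assms by (simp add: linear_continuous_on)
next
  case (Suc n)
  have "frechet_derivative f (at x) = f" for x
    using bounded_linear_imp_has_derivative[OF assms] by (metis frechet_derivative_at)
  then show ?thesis
    using Suc bounded_linear_imp_differentiable[OF assms] by simp
qed

lemma C_k_on_add:
  assumes "open U"
  shows "C_k_on k f U \<Longrightarrow> C_k_on k g U \<Longrightarrow> C_k_on k (\<lambda>x. f x + g x) U"
proof (induction k arbitrary: f g)
  case 0
  then show ?case by (auto intro: continuous_intros)
next
  case (Suc k)
  show ?case
  proof (rule C_k_on_SucI[OF assms])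
    show "((\<lambda>x. f x + g x) has_derivative
        (\<lambda>v. frechet_derivative f (at x) v + frechet_derivative g (at x) v)) (at x)" if "x \<in> U" for x
      by (intro has_derivative_add C_k_on_SucD[OF Suc.prems(1) that] C_k_on_SucD[OF Suc.prems(2) that])
  qed (use Suc in auto)
qed

text \<open>One induction serves products, scaling and inner products: each Leibniz term is again
  \<open>h\<close> of two \<open>C_k_on k\<close> functions, an undifferentiated factor being one
  order better than required.\<close>

lemma C_k_on_bilinear:
  assumes "open U" "bounded_bilinear h"
  shows "C_k_on k f U \<Longrightarrow> C_k_on k g U \<Longrightarrow> C_k_on k (\<lambda>x. h (f x) (g x)) U"
proof (induction k arbitrary: f g)
  case 0
  then show ?case by (auto intro: bounded_bilinear.continuous_on[OF assms(2)])
next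
  case (Suc k)
  have f: "C_k_on k f U" and g: "C_k_on k g U"
    using Suc.prems C_k_on_Suc_imp by blast+
  show ?case
  proof (rule C_k_on_SucI[OF assms(1)])
    show "((\<lambda>x. h (f x) (g x)) has_derivative
        (\<lambda>v. h (f x) (frechet_derivative g (at x) v) + h (frechet_derivative f (at x) v) (g x))) (at x)"
      if "x \<in> U" for x
      by (rule bounded_bilinear.FDERIV[OF assms(2)])
         (use that Suc.prems in \<open>auto intro: C_k_on_SucD\<close>)
    show "C_k_on k (\<lambda>x. h (f x) (frechet_derivative g (at x) v) +
        h (frechet_derivative f (at x) v) (g x)) U" for v
      by (intro C_k_on_add[OF assms(1)] Suc.IH f g) (use Suc.prems in auto)
  qed
qed

lemmas C_k_on_mult = C_k_on_bilinear[OF _ bounded_bilinear_mult]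
lemmas C_k_on_scaleR = C_k_on_bilinear[OF _ bounded_bilinear_scaleR]
lemmas C_k_on_inner = C_k_on_bilinear[OF _ bounded_bilinear_inner]

lemma C_k_on_linear_comp:
  assumes "open U" "bounded_linear h" "C_k_on k f U"
  shows "C_k_on k (\<lambda>x. h (f x)) U"
  using assms(3)
proof (induction k arbitrary: f)
  case 0
  then show ?case using bounded_linear.continuous_on[OF assms(2)] by auto
next
  case (Suc k)
  show ?case
  proof (rule C_k_on_SucI[OF assms(1)])
    show "((\<lambda>x. h (f x)) has_derivative (\<lambda>v. h (frechet_derivative f (at x) v))) (at x)"
      if "x \<in> U" for x
      by (intro bounded_linear.has_derivative[OF assms(2)] C_k_on_SucD[OF Suc.prems that])
  qed (use Suc in auto)
qed

lemma C_k_on_minus: "open U \<Longrightarrow> C_k_on k f U \<Longrightarrow> C_k_on k (\<lambda>x. - f x) U"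
  by (rule C_k_on_linear_comp[OF _ bounded_linear_minus[OF bounded_linear_ident]])

lemma C_k_on_diff:
  "open U \<Longrightarrow> C_k_on k f U \<Longrightarrow> C_k_on k g U \<Longrightarrow> C_k_on k (\<lambda>x. f x - g x) U"
  using C_k_on_add[of U k f "\<lambda>x. - g x"] C_k_on_minus[of U k g] by simp

lemma C_k_on_sum:
  assumes "open U" "\<And>i. i \<in> S \<Longrightarrow> C_k_on k (f i) U"
  shows "C_k_on k (\<lambda>x. \<Sum>i\<in>S. f i x) U"
  using assms(2) by (induction S rule: infinite_finite_induct) (auto intro!: C_k_on_add[OF assms(1)])

lemma C_k_on_componentwise:
  assumes "open U" "\<And>e. e \<in> Basis \<Longrightarrow> C_k_on k (\<lambda>x. f x \<bullet> e) U"
  shows "C_k_on k f U"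
proof -
  have "C_k_on k (\<lambda>x. \<Sum>e\<in>Basis. (f x \<bullet> e) *\<^sub>R e) U"
    by (intro C_k_on_sum C_k_on_scaleR assms C_k_on_const)
  then show ?thesis by (simp add: euclidean_representation)
qed

lemma C_k_on_compose:
  assumes "open U" "open V" "f ` U \<subseteq> V"
  shows "C_k_on k g V \<Longrightarrow> C_k_on k f U \<Longrightarrow> C_k_on k (\<lambda>x. g (f x)) U"
proof (induction k arbitrary: g)
  case 0
  then show ?case using continuous_on_compose2 assms(3) by (metis C_k_on.simps(1))
next
  case (Suc k)
  let ?f = "\<lambda>x. frechet_derivative f (at x)" and ?g = "\<lambda>x. frechet_derivative g (at x)"
  show ?case
  proof (rule C_k_on_SucI[OF assms(1)])
    show "((\<lambda>x. g (f x)) has_derivative (\<lambda>v. ?g (f x) (?f x v))) (at x)" if "x \<in> U" for x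
      using diff_chain_at[OF C_k_on_SucD[OF Suc.prems(2) that] C_k_on_SucD[OF Suc.prems(1), of "f x"]]
        that assms(3) by (auto simp: o_def)
    \<comment> \<open>In the chain rule the direction \<open>?f x v\<close> moves with
      \<open>x\<close>, whereas \<open>C_k_on\<close> tests fixed directions; expanding it in the
      basis restores fixed ones.\<close>
    have "?g (f x) (?f x v) = (\<Sum>e\<in>Basis. (?f x v \<bullet> e) *\<^sub>R ?g (f x) e)" if "x \<in> U" for x v
    proof -
      have "bounded_linear (?g (f x))"
        using C_k_on_SucD[OF Suc.prems(1), of "f x"] that assms(3)
        by (auto dest: has_derivative_bounded_linear)
      then have l: "linear (?g (f x))" by (rule bounded_linear.linear)
      have "?g (f x) (?f x v) = ?g (f x) (\<Sum>e\<in>Basis. (?f x v \<bullet> e) *\<^sub>R e)"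
        by (simp add: euclidean_representation)
      also have "\<dots> = (\<Sum>e\<in>Basis. (?f x v \<bullet> e) *\<^sub>R ?g (f x) e)"
        by (simp add: linear_sum[OF l] linear_scale[OF l])
      finally show ?thesis .
    qed
    moreover have "C_k_on k (\<lambda>x. \<Sum>e\<in>Basis. (?f x v \<bullet> e) *\<^sub>R ?g (f x) e) U" for v
      using Suc.prems C_k_on_Suc_imp
      by (intro C_k_on_sum C_k_on_scaleR C_k_on_inner assms(1) C_k_on_const Suc.IH) auto
    ultimately show "C_k_on k (\<lambda>x. ?g (f x) (?f x v)) U" for v
      using C_k_on_cong[OF assms(1), of "\<lambda>x. ?g (f x) (?f x v)"] by simp
  qed
qed

text \<open>The derivative is a product of copies of \<open>inverse\<close> itself and a constant,
  so the induction hypothesis applies to its own derivative. The two-sided form is the one valid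
  without commutativity.\<close>

lemma C_k_on_inverse_id:
  "C_k_on k (inverse :: 'a::{euclidean_space, real_normed_div_algebra} \<Rightarrow> 'a) (- {0})"
proof (induction k)
  case 0
  then show ?case by (auto intro!: continuous_intros)
next
  case (Suc k)
  have o: "open (- {0::'a})" by auto
  show ?case
  proof (rule C_k_on_SucI[OF o])
    show "(inverse has_derivative (\<lambda>v. - (inverse x * v * inverse x))) (at x)"
      if "x \<in> - {0}" for x :: 'a
      using that by (intro has_derivative_inverse') auto
    show "C_k_on k (\<lambda>x. - (inverse x * v * inverse x)) (- {0})" for v :: 'a
      by (intro C_k_on_minus C_k_on_mult Suc o C_k_on_const)
  qed
qed

lemma C_k_on_inverse:
  fixes f :: "_ \<Rightarrow> 'a::{euclidean_space, real_normed_div_algebra}"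
  assumes "open U" "C_k_on k f U" "\<And>x. x \<in> U \<Longrightarrow> f x \<noteq> 0"
  shows "C_k_on k (\<lambda>x. inverse (f x)) U"
  by (rule C_k_on_compose[OF assms(1) _ _ C_k_on_inverse_id assms(2)]) (use assms(3) in auto)

lemma C_k_on_norm_id: "C_k_on k (norm :: 'a::euclidean_space \<Rightarrow> real) (- {0})"
proof (induction k)
  case 0
  then show ?case by (auto intro!: continuous_intros)
next
  case (Suc k)
  have o: "open (- {0::'a})" by auto
  show ?case
  proof (rule C_k_on_SucI[OF o])
    show "(norm has_derivative (\<lambda>v. (x \<bullet> v) * inverse (norm x))) (at x)"
      if "x \<in> - {0}" for x :: 'a
      using has_derivative_norm[of x] that
      by (simp add: sgn_div_norm inner_commute divide_inverse mult.commute)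
    show "C_k_on k (\<lambda>x. (x \<bullet> v) * inverse (norm x)) (- {0})" for v :: 'a
      by (intro C_k_on_mult C_k_on_inner C_k_on_inverse Suc o C_k_on_const
          C_k_on_linear[OF bounded_linear_ident]) auto
  qed
qed

lemma C_k_on_norm:
  assumes "open U" "C_k_on k f U" "\<And>x. x \<in> U \<Longrightarrow> f x \<noteq> 0"
  shows "C_k_on k (\<lambda>x. norm (f x)) U"
  by (rule C_k_on_compose[OF assms(1) _ _ C_k_on_norm_id assms(2)]) (use assms(3) in auto)

lemma holomorphic_on_imp_C_k_on:
  assumes "open U" "f holomorphic_on U"
  shows "C_k_on k f U"
  using assms(2)
proof (induction k arbitrary: f)
  case 0
  then show ?case by (simp add: holomorphic_on_imp_continuous_on)
next
  case (Suc k)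
  show ?case
  proof (rule C_k_on_SucI[OF assms(1)])
    show "(f has_derivative (\<lambda>v. deriv f x * v)) (at x)" if "x \<in> U" for x
      using holomorphic_derivI[OF Suc.prems assms(1) that, of UNIV]
      by (simp add: has_field_derivative_def)
    show "C_k_on k (\<lambda>x. deriv f x * v) U" for v
      by (intro C_k_on_mult assms(1) C_k_on_const Suc.IH holomorphic_deriv Suc.prems)
  qed
qed

text \<open>Bootstrapping: the derivative of \<open>g\<close> is \<open>R\<close> composed with
  \<open>g\<close>, so each order of smoothness of \<open>g\<close> yields the next one.\<close>

lemma C_k_on_local_inverse:
  assumes "open U" "open V" "\<And>y. y \<in> V \<Longrightarrow> g y \<in> U"
    and g: "\<And>y. y \<in> V \<Longrightarrow> (g has_derivative R (g y)) (at y)"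
    and R: "\<And>k v. C_k_on k (\<lambda>x. R x v) U"
  shows "C_k_on k g V"
proof (induction k)
  case 0
  show ?case
    using g has_derivative_continuous continuous_at_imp_continuous_on C_k_on.simps(1) by metis
next
  case (Suc k)
  show ?case
    by (rule C_k_on_SucI[OF assms(2) g])
      (auto intro!: C_k_on_compose[OF assms(2,1) _ R Suc] assms(3))
qed


section \<open>Left multiplication by unit imaginary quaternions\<close>

lemma of_real_quat_sel [simp]:
  "qRe (of_real r) = r" "qI (of_real r) = 0" "qJ (of_real r) = 0" "qK (of_real r) = 0"
  by (simp_all add: of_real_def)

lemma quat_in_Reals_iff: "q \<in> \<real> \<longleftrightarrow> qI q = 0 \<and> qJ q = 0 \<and> qK q = 0"
proof
  assume "qI q = 0 \<and> qJ q = 0 \<and> qK q = 0"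
  then have "q = of_real (qRe q)" by (simp add: quat_eq_iff)
  then show "q \<in> \<real>" by (metis Reals_of_real)
qed (auto elim: Reals_cases)

lemma unit_imag_iff:
  "I \<in> unit_imag \<longleftrightarrow> qRe I = 0 \<and> (qI I)\<^sup>2 + (qJ I)\<^sup>2 + (qK I)\<^sup>2 = 1"
proof
  assume "I \<in> unit_imag"
  then have e: "(qRe I)\<^sup>2 - (qI I)\<^sup>2 - (qJ I)\<^sup>2 - (qK I)\<^sup>2 = -1"
    "qRe I * qI I = 0" "qRe I * qJ I = 0" "qRe I * qK I = 0"
    by (auto simp: unit_imag_def quat_eq_iff power2_eq_square)
  have "qRe I = 0"
  proof (rule ccontr)
    assume "qRe I \<noteq> 0"
    with e have "(qRe I)\<^sup>2 = -1" by simp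
    then show False using zero_le_power2[of "qRe I"] by linarith
  qed
  with e show "qRe I = 0 \<and> (qI I)\<^sup>2 + (qJ I)\<^sup>2 + (qK I)\<^sup>2 = 1" by simp
next
  assume "qRe I = 0 \<and> (qI I)\<^sup>2 + (qJ I)\<^sup>2 + (qK I)\<^sup>2 = 1"
  then show "I \<in> unit_imag"
    by (auto simp: unit_imag_def quat_eq_iff power2_eq_square)
qed

lemma unit_imag_iff_norm: "I \<in> unit_imag \<longleftrightarrow> qRe I = 0 \<and> norm I = 1"
  by (auto simp: unit_imag_iff norm_quat_def inner_quat_def power2_eq_square)

lemma unit_imagD:
  assumes "I \<in> unit_imag"
  shows "qRe I = 0" "norm I = 1" "I * I = -1" "I \<noteq> 0" "I * (I * q) = - q" "- I \<in> unit_imag"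
  using assms unit_imag_iff_norm[of I]
  by (auto simp: unit_imag_def power2_eq_square mult.assoc[symmetric])

lemma inner_imag_mult_left: "qRe I = 0 \<Longrightarrow> (I * p) \<bullet> q = - (p \<bullet> (I * q))"
  by (simp add: inner_quat_def algebra_simps)

lemma inner_unit_imag_mult:
  assumes "I \<in> unit_imag"
  shows "(I * p) \<bullet> (I * q) = p \<bullet> q"
  using inner_imag_mult_left[of I p "I * q"] unit_imagD[OF assms] by simp

lemma bounded_linear_quat_sel:
  "bounded_linear qRe" "bounded_linear qI" "bounded_linear qJ" "bounded_linear qK"
proof -
  have "qRe = (\<lambda>q. q \<bullet> Quat 1 0 0 0)" "qI = (\<lambda>q. q \<bullet> Quat 0 1 0 0)"
    "qJ = (\<lambda>q. q \<bullet> Quat 0 0 1 0)" "qK = (\<lambda>q. q \<bullet> Quat 0 0 0 1)"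
    by (auto simp: inner_quat_def)
  then show "bounded_linear qRe" "bounded_linear qI" "bounded_linear qJ" "bounded_linear qK"
    using bounded_linear_inner_left by metis+
qed

lemma bounded_linear_quat_Im: "bounded_linear quat_Im"
  unfolding quat_Im_def
  by (intro bounded_linear_sub bounded_linear_ident
      bounded_linear_compose[OF bounded_linear_of_real bounded_linear_quat_sel(1)])

lemma quat_Im_sel [simp]:
  "qRe (quat_Im q) = 0" "qI (quat_Im q) = qI q" "qJ (quat_Im q) = qJ q" "qK (quat_Im q) = qK q"
  by (simp_all add: quat_Im_def)

lemma quat_Im_eq_0_iff: "quat_Im q = 0 \<longleftrightarrow> q \<in> \<real>"
  by (simp add: quat_eq_iff quat_in_Reals_iff)

lemma imag_dir_unit_imag: "q \<notin> \<real> \<Longrightarrow> imag_dir q \<in> unit_imag"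
  by (simp add: unit_imag_iff_norm imag_dir_def quat_Im_eq_0_iff)

lemma slice_pt_imag_dir: "q \<notin> \<real> \<Longrightarrow> slice_pt (imag_dir q) (qRe q) (norm (quat_Im q)) = q"
  by (simp add: slice_pt_def imag_dir_def quat_Im_eq_0_iff) (simp add: quat_Im_def)

lemma slice_pt_sel [simp]:
  assumes "I \<in> unit_imag"
  shows "qRe (slice_pt I x y) = x" "quat_Im (slice_pt I x y) = y *\<^sub>R I"
  using unit_imagD(1)[OF assms] by (simp_all add: slice_pt_def quat_Im_def)

lemma imag_dir_slice_pt: "I \<in> unit_imag \<Longrightarrow> y > 0 \<Longrightarrow> imag_dir (slice_pt I x y) = I"
  by (simp add: imag_dir_def unit_imagD)

text \<open>The orthogonal projection of \<open>\<real>\<^sup>4\<close> onto the slice \<open>\<real> + I\<real>\<close>; it is linear over that slice.\<close>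

definition slice_proj :: "quat \<Rightarrow> quat \<Rightarrow> quat" where
  "slice_proj I h = of_real (qRe h) + (I \<bullet> h) *\<^sub>R I"

lemma slice_proj_add: "slice_proj I (p + q) = slice_proj I p + slice_proj I q"
  and slice_proj_diff: "slice_proj I (p - q) = slice_proj I p - slice_proj I q"
  and slice_proj_scaleR: "slice_proj I (r *\<^sub>R p) = r *\<^sub>R slice_proj I p"
  by (simp_all add: slice_proj_def inner_simps algebra_simps of_real_def)

lemma slice_proj_imag_mult:
  assumes "I \<in> unit_imag"
  shows "slice_proj I (I * h) = I * slice_proj I h"
proof -
  have "qRe (I * h) = - (I \<bullet> h)" using unit_imagD(1)[OF assms] by (simp add: inner_quat_def)
  moreover have "I \<bullet> (I * h) = qRe h"
    using inner_unit_imag_mult[OF assms, of 1 h] by (simp add: inner_quat_def)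
  ultimately show ?thesis
    using unit_imagD(3)[OF assms] by (simp add: slice_proj_def distrib_left of_real_def)
qed

lemma slice_proj_idem:
  assumes "I \<in> unit_imag"
  shows "slice_proj I (slice_proj I h) = slice_proj I h"
proof -
  have "I \<bullet> of_real (qRe h) = 0" "I \<bullet> I = 1"
    using unit_imagD[OF assms] by (simp_all add: inner_quat_def[of I "of_real _"] flip: power2_norm_eq_inner)
  then show ?thesis
    using unit_imagD(1)[OF assms] by (simp add: slice_proj_def inner_simps)
qed

lemma slice_proj_mult:
  assumes "I \<in> unit_imag"
  shows "slice_proj I (slice_proj I u * h) = slice_proj I u * slice_proj I h"
  using slice_proj_imag_mult[OF assms]
  by (simp add: slice_proj_def[of I u] distrib_right slice_proj_add slice_proj_scaleR
      scaleR_conv_of_real[symmetric] of_real_def)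

lemma slice_proj_inverse:
  assumes "I \<in> unit_imag"
  shows "slice_proj I (inverse (slice_proj I h)) = inverse (slice_proj I h)"
proof (cases "slice_proj I h = 0")
  case False
  let ?s = "slice_proj I h"
  have "?s * slice_proj I (inverse ?s) = slice_proj I (?s * inverse ?s)"
    using slice_proj_mult[OF assms] by simp
  also have "\<dots> = ?s * inverse ?s"
    using False unit_imagD(1)[OF assms] by (simp add: slice_proj_def inner_quat_def)
  finally show ?thesis using False inverse_unique by fastforce
qed (simp add: slice_proj_def inner_quat_def of_real_def)

text \<open>\<open>slice_diff I A C\<close> is the shape of the differential of a regular function at a point of the slice
  of \<open>I\<close>, with \<open>A\<close> the slice derivative and \<open>C\<close> the spherical derivative. Its inverse is found by
  right division by \<open>C\<close>: projecting \<open>u A C\<^sup>-\<^sup>1 + w\<close>, with \<open>u\<close> in the slice and \<open>w\<close> orthogonal to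
  it, determines \<open>u\<close>.\<close>

definition slice_diff :: "quat \<Rightarrow> quat \<Rightarrow> quat \<Rightarrow> quat \<Rightarrow> quat" where
  "slice_diff I A C h = slice_proj I h * A + (h - slice_proj I h) * C"

definition slice_diff_inv :: "quat \<Rightarrow> quat \<Rightarrow> quat \<Rightarrow> quat \<Rightarrow> quat" where
  "slice_diff_inv I A C v =
     (let u = slice_proj I (v * inverse C) * inverse (slice_proj I (A * inverse C))
      in u + (v - u * A) * inverse C)"

lemma slice_diff_inverse:
  assumes I: "I \<in> unit_imag" and C: "C \<noteq> 0" and s: "slice_proj I (A * inverse C) \<noteq> 0"
  shows "slice_diff I A C (slice_diff_inv I A C v) = v"
    and "slice_diff_inv I A C (slice_diff I A C h) = h"
proof -
  let ?P = "slice_proj I" and ?s = "slice_proj I (A * inverse C)"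
  define u where "u = ?P (v * inverse C) * inverse ?s"
  have Pu: "?P u = u"
    unfolding u_def using slice_proj_mult[OF I] slice_proj_inverse[OF I] by simp
  have "?P ((v - u * A) * inverse C) = ?P (v * inverse C) - ?P (u * (A * inverse C))"
    by (simp add: left_diff_distrib slice_proj_diff mult.assoc)
  also have "?P (u * (A * inverse C)) = u * ?s"
    using slice_proj_mult[OF I, of u] Pu by simp
  also have "\<dots> = ?P (v * inverse C)"
    using s by (simp add: u_def mult.assoc)
  finally have P: "?P (slice_diff_inv I A C v) = u"
    unfolding slice_diff_inv_def Let_def u_def[symmetric] by (simp add: slice_proj_add Pu)
  have "slice_diff_inv I A C v = u + (v - u * A) * inverse C"
    by (simp add: slice_diff_inv_def Let_def u_def)
  then show "slice_diff I A C (slice_diff_inv I A C v) = v"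
    unfolding slice_diff_def P using C by (simp add: mult.assoc)
  have "slice_diff I A C h * inverse C = ?P h * (A * inverse C) + (h - ?P h)"
    using C by (simp add: slice_diff_def distrib_right mult.assoc)
  then have "?P (slice_diff I A C h * inverse C) * inverse ?s = ?P h"
    using s by (simp add: slice_proj_add slice_proj_mult[OF I] slice_proj_diff slice_proj_idem[OF I] mult.assoc)
  then show "slice_diff_inv I A C (slice_diff I A C h) = h"
    unfolding slice_diff_inv_def using C by (simp add: Let_def slice_diff_def mult.assoc)
qed

lemma slice_diff_imag_mult:
  assumes "I \<in> unit_imag"
  shows "slice_diff I A C (I * h) = I * slice_diff I A C h"
  using slice_proj_imag_mult[OF assms]
  by (simp add: slice_diff_def distrib_left left_diff_distrib right_diff_distrib mult.assoc)

text \<open>Right multiplication by \<open>C\<close> is a similarity that scales inner products by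
  \<open>C \<bullet> C\<close>.\<close>

lemma inner_mult_inverse_quat:
  fixes C :: quat
  assumes "C \<noteq> 0"
  shows "(p * inverse C) \<bullet> r = (p \<bullet> (r * C)) / (C \<bullet> C)"
proof -
  have "((p * inverse C) * C) \<bullet> (r * C) = ((p * inverse C) \<bullet> r) * (C \<bullet> C)" for r
    unfolding inner_quat_def times_quat.sel by algebra
  then show ?thesis using assms by (simp add: mult.assoc)
qed

text \<open>Turns two real equations into a point of a sphere \<open>I * c\<close>. The only
  candidate is \<open>d * inverse c\<close>: equal lengths give it norm one, and orthogonality kills
  its real part.\<close>

lemma exists_unit_imag_mult:
  fixes c :: quat
  assumes "c \<noteq> 0" "d \<bullet> d = c \<bullet> c" "d \<bullet> c = 0"
  shows "\<exists>I\<in>unit_imag. I * c = d"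
proof
  show "(d * inverse c) * c = d" using assms(1) by (simp add: mult.assoc)
  have "qRe (d * inverse c) = (d * inverse c) \<bullet> 1" by (simp add: inner_quat_def)
  also have "\<dots> = 0" using assms by (simp add: inner_mult_inverse_quat)
  finally have "qRe (d * inverse c) = 0" .
  moreover have "norm d = norm c" using assms(2) by (simp add: norm_eq_sqrt_inner)
  ultimately show "d * inverse c \<in> unit_imag"
    using assms(1) by (simp add: unit_imag_iff_norm norm_mult norm_inverse del: times_quat.sel)
qed

text \<open>The projection vanishes iff its argument is orthogonal to 1 and \<open>I\<close>; moving
  \<open>inverse C\<close> across the inner product gives the two conditions in which a singular
  differential will be expressed.\<close>

lemma slice_proj_mult_inverse_eq_0_iff:
  assumes I: "I \<in> unit_imag" and C: "C \<noteq> 0"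
  shows "slice_proj I (A * inverse C) = 0 \<longleftrightarrow> A \<bullet> C = 0 \<and> A \<bullet> (I * C) = 0"
proof -
  have "slice_proj I h = 0 \<longleftrightarrow> h \<bullet> 1 = 0 \<and> h \<bullet> I = 0" for h
  proof
    assume 0: "slice_proj I h = 0"
    have "qRe (slice_proj I h) = h \<bullet> 1"
      using unit_imagD(1)[OF I] by (simp add: slice_proj_def inner_quat_def)
    then have h1: "h \<bullet> 1 = 0" by (simp add: 0)
    then have "(I \<bullet> h) *\<^sub>R I = 0"
      using 0 by (simp add: slice_proj_def inner_quat_def[of h])
    then show "h \<bullet> 1 = 0 \<and> h \<bullet> I = 0"
      using h1 unit_imagD(4)[OF I] by (simp add: inner_commute)
  qed (simp add: slice_proj_def inner_quat_def[of h 1] inner_commute[of I])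
  then show ?thesis using C by (simp add: inner_mult_inverse_quat)
qed

section \<open>Determinants and the orientation\<close>

lemma det_4:
  "det (A::'a::comm_ring_1^4^4) =
    A$1$1 * A$2$2 * A$3$3 * A$4$4 - A$1$1 * A$2$2 * A$3$4 * A$4$3
  - A$1$1 * A$2$3 * A$3$2 * A$4$4 + A$1$1 * A$2$3 * A$3$4 * A$4$2
  + A$1$1 * A$2$4 * A$3$2 * A$4$3 - A$1$1 * A$2$4 * A$3$3 * A$4$2
  - A$1$2 * A$2$1 * A$3$3 * A$4$4 + A$1$2 * A$2$1 * A$3$4 * A$4$3
  + A$1$2 * A$2$3 * A$3$1 * A$4$4 - A$1$2 * A$2$3 * A$3$4 * A$4$1
  - A$1$2 * A$2$4 * A$3$1 * A$4$3 + A$1$2 * A$2$4 * A$3$3 * A$4$1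
  + A$1$3 * A$2$1 * A$3$2 * A$4$4 - A$1$3 * A$2$1 * A$3$4 * A$4$2
  - A$1$3 * A$2$2 * A$3$1 * A$4$4 + A$1$3 * A$2$2 * A$3$4 * A$4$1
  + A$1$3 * A$2$4 * A$3$1 * A$4$2 - A$1$3 * A$2$4 * A$3$2 * A$4$1
  - A$1$4 * A$2$1 * A$3$2 * A$4$3 + A$1$4 * A$2$1 * A$3$3 * A$4$2
  + A$1$4 * A$2$2 * A$3$1 * A$4$3 - A$1$4 * A$2$2 * A$3$3 * A$4$1
  - A$1$4 * A$2$3 * A$3$1 * A$4$2 + A$1$4 * A$2$3 * A$3$2 * A$4$1"
proof -
  have f1: "finite {4::4}" "1 \<notin> {2::4, 3, 4}" and f2: "2 \<notin> {3::4, 4}" and f3: "3 \<notin> {4::4}"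
    by auto
  show ?thesis
    unfolding det_def UNIV_4
    by (subst sum_over_permutations_insert[OF _ f1(2)], simp,
        subst sum_over_permutations_insert[OF _ f2], simp,
        subst sum_over_permutations_insert[OF _ f3], simp,
        simp add: permutes_sing sign_swap_id permutation_swap_id sign_compose permutation_compose
          sign_id swap_id_eq algebra_simps)
qed

lemma vector_4:
  "(vector [w, x, y, z] :: 'a::zero^4) $ 1 = w" "(vector [w, x, y, z] :: 'a::zero^4) $ 2 = x"
  "(vector [w, x, y, z] :: 'a::zero^4) $ 3 = y" "(vector [w, x, y, z] :: 'a::zero^4) $ 4 = z"
  by (simp_all add: vector_def)

text \<open>For nonzero \<open>v\<close> the right-hand side is the squared length of
  \<open>v\<close> times the squared distance of \<open>w\<close> from the plane of \<open>v\<close>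
  and \<open>I * v\<close>; this is what makes the sign visible.\<close>

lemma det_complex_line_pair:
  assumes "I \<in> unit_imag"
  shows "det (vector [quat_coords v, quat_coords (I * v), quat_coords w, quat_coords (I * w)] :: real^4^4) =
    (v \<bullet> v) * (w \<bullet> w) - (v \<bullet> w)\<^sup>2 - ((I * v) \<bullet> w)\<^sup>2"
proof -
  obtain a b c where I: "I = Quat 0 a b c" "a\<^sup>2 + b\<^sup>2 + c\<^sup>2 = 1"
    using assms unit_imag_iff[of I] by (metis quat.collapse)
  \<comment> \<open>The factor \<open>a\<^sup>2 + b\<^sup>2 + c\<^sup>2\<close> makes both sides
    homogeneous of degree two in \<open>a\<close>, \<open>b\<close>, \<open>c\<close>, so that this
    is a polynomial identity; its value 1 is inserted afterwards.\<close>
  have "det (vector [quat_coords v, quat_coords (I * v), quat_coords w, quat_coords (I * w)] :: real^4^4) =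
    (a\<^sup>2 + b\<^sup>2 + c\<^sup>2) * ((v \<bullet> v) * (w \<bullet> w) - (v \<bullet> w)\<^sup>2) - ((I * v) \<bullet> w)\<^sup>2"
    unfolding I(1) det_4 vector_4 quat_coords_def inner_quat_def times_quat.sel quat.sel
    by algebra
  then show ?thesis by (simp add: I(2))
qed

text \<open>\<open>d\<close> is the Gram-Schmidt remainder of \<open>w\<close> against the
  orthogonal vectors \<open>v\<close> and \<open>I * v\<close>. It is nonzero by the span
  hypothesis, and \<open>n * (d \<bullet> d)\<close> is the determinant.\<close>

lemma positively_oriented_unit_imag_mult:
  assumes I: "I \<in> unit_imag" and v: "v \<noteq> 0" and w: "w \<notin> span {v, I * v}"
  shows "positively_oriented v (I * v) w (I * w)"
proof -
  define n where "n = v \<bullet> v"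
  define d where "d = w - ((v \<bullet> w) / n) *\<^sub>R v - (((I * v) \<bullet> w) / n) *\<^sub>R (I * v)"
  have n: "n > 0" using v by (simp add: n_def)
  have "d \<noteq> 0"
  proof
    assume "d = 0"
    then have "w = ((v \<bullet> w) / n) *\<^sub>R v + (((I * v) \<bullet> w) / n) *\<^sub>R (I * v)"
      by (simp add: d_def algebra_simps)
    also have "\<dots> \<in> span {v, I * v}"
      by (intro span_add span_scale span_base) auto
    finally show False using w by simp
  qed
  have vI: "v \<bullet> (I * v) = 0" "(I * v) \<bullet> v = 0"
    using inner_imag_mult_left[of I v v] unit_imagD(1)[OF I] by (auto simp: inner_commute)
  have II: "(I * v) \<bullet> (I * v) = n"
    using inner_unit_imag_mult[OF I] by (simp add: n_def)
  define x y where "x = v \<bullet> w" and "y = (I * v) \<bullet> w"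
  have "d \<bullet> d = w \<bullet> w - 2 * (x / n) * x - 2 * (y / n) * y + (x / n)\<^sup>2 * n + (y / n)\<^sup>2 * n"
    unfolding d_def x_def[symmetric] y_def[symmetric]
    by (simp add: inner_diff_left inner_diff_right vI II n_def[symmetric] inner_commute[of w v]
        inner_commute[of w "I * v"] x_def[symmetric] y_def[symmetric] power2_eq_square algebra_simps)
  then have "n * (d \<bullet> d) = n * (w \<bullet> w) - x\<^sup>2 - y\<^sup>2"
    using n by (simp only:) (simp add: field_simps power2_eq_square)
  moreover have "n * (d \<bullet> d) > 0" using n \<open>d \<noteq> 0\<close> by simp
  ultimately show ?thesis
    unfolding positively_oriented_def det_complex_line_pair[OF I] by (simp add: n_def x_def y_def)
qed


section \<open>The representation formula\<close>

text \<open>For unit imaginary \<open>I\<close> this map to \<open>\<complex>\<close> turns left multiplication by \<open>I\<close> into multiplication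
  by \<open>\<i>\<close>; it replaces the splitting lemma.\<close>

definition slice_functional :: "quat \<Rightarrow> quat \<Rightarrow> quat \<Rightarrow> complex" where
  "slice_functional I v q = Complex (q \<bullet> v) (q \<bullet> (I * v))"

lemma bounded_linear_slice_functional: "bounded_linear (slice_functional I v)"
proof -
  have "slice_functional I v = (\<lambda>q. of_real (q \<bullet> v) + \<i> * of_real (q \<bullet> (I * v)))"
    by (auto simp: slice_functional_def complex_eq_iff)
  then show ?thesis
    by (auto intro!: bounded_linear_add bounded_linear_compose[OF bounded_linear_of_real]
        bounded_linear_const_mult bounded_linear_inner_left)
qed

lemma slice_functional_imag_mult:
  assumes "I \<in> unit_imag"
  shows "slice_functional I v (I * q) = \<i> * slice_functional I v q"
  using inner_unit_imag_mult[OF assms] unit_imagD(1)[OF assms]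
  by (simp add: slice_functional_def complex_eq_iff inner_imag_mult_left)

text \<open>The Cauchy-Riemann equation reads \<open>L (0, 1) = I * L (1, 0)\<close>. Since the
  functional turns \<open>I\<close> into \<open>\<i>\<close>, the composed differential is
  multiplication by a complex number.\<close>

lemma slice_regular_holomorphic:
  assumes f: "slice_regular_on f \<Omega>" and I: "I \<in> unit_imag"
    and D: "open D" "\<And>z. z \<in> D \<Longrightarrow> slice_pt I (Re z) (Im z) \<in> \<Omega>"
  shows "(\<lambda>z. slice_functional I v (f (slice_pt I (Re z) (Im z)))) holomorphic_on D"
proof -
  let ?g = "\<lambda>(s, t). f (slice_pt I s t)" and ?l = "slice_functional I v"
  have "((\<lambda>z. ?l (f (slice_pt I (Re z) (Im z)))) has_field_derivative ?l (L (1, 0))) (at z)"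
    if z: "z \<in> D" and L: "(?g has_derivative L) (at (Re z, Im z))" for z L
  proof -
    let ?x = "Re z" and ?y = "Im z"
    have lin: "bounded_linear L" using L by (rule has_derivative_bounded_linear)
    have L_eq: "L (a, b) = a *\<^sub>R L (1, 0) + b *\<^sub>R L (0, 1)" for a b
      using linear_add[OF bounded_linear.linear[OF lin], of "(a, 0)" "(0, b)"]
        linear_scale[OF bounded_linear.linear[OF lin], of a "(1, 0)"]
        linear_scale[OF bounded_linear.linear[OF lin], of b "(0, 1)"] by simp
    have Lx: "(\<lambda>h. L (h, 0)) = (\<lambda>h. h *\<^sub>R L (1, 0))" and Ly: "(\<lambda>h. L (0, h)) = (\<lambda>h. h *\<^sub>R L (0, 1))"
      using L_eq[of _ 0] L_eq[of 0] by (metis add_0 add.right_neutral scaleR_zero_left)+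
    have "((\<lambda>s. ?g (s, ?y)) has_derivative (\<lambda>h. L (h, 0))) (at ?x)"
      by (rule has_derivative_compose[OF has_derivative_Pair[OF has_derivative_ident has_derivative_const] L])
    then have "((\<lambda>s. f (slice_pt I s ?y)) has_vector_derivative L (1, 0)) (at ?x)"
      by (simp add: has_vector_derivative_def Lx)
    then have dx: "vector_derivative (\<lambda>s. f (slice_pt I s ?y)) (at ?x) = L (1, 0)"
      by (rule vector_derivative_at)
    have "((\<lambda>t. ?g (?x, t)) has_derivative (\<lambda>h. L (0, h))) (at ?y)"
      by (rule has_derivative_compose[OF has_derivative_Pair[OF has_derivative_const has_derivative_ident] L])
    then have "((\<lambda>t. f (slice_pt I ?x t)) has_vector_derivative L (0, 1)) (at ?y)"
      by (simp add: has_vector_derivative_def Ly)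
    then have dy: "vector_derivative (\<lambda>t. f (slice_pt I ?x t)) (at ?y) = L (0, 1)"
      by (rule vector_derivative_at)
    have "L (1, 0) + I * L (0, 1) = 0"
      using f I D(2)[OF z] unfolding slice_regular_on_def dx[symmetric] dy[symmetric] by auto
    then have "I * L (1, 0) + I * (I * L (0, 1)) = 0"
      by (metis distrib_left mult_zero_right)
    then have L01: "L (0, 1) = I * L (1, 0)"
      using unit_imagD(5)[OF I] by simp
    have "((\<lambda>z. ?g (Re z, Im z)) has_derivative (\<lambda>h. L (Re h, Im h))) (at z)"
      by (rule has_derivative_compose[OF has_derivative_Pair[OF
            bounded_linear_imp_has_derivative[OF bounded_linear_Re]
            bounded_linear_imp_has_derivative[OF bounded_linear_Im]] L])
    then have "((\<lambda>z. ?l (f (slice_pt I (Re z) (Im z)))) has_derivative (\<lambda>h. ?l (L (Re h, Im h)))) (at z)"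
      using bounded_linear.has_derivative[OF bounded_linear_slice_functional] by simp
    moreover have "?l (L (Re h, Im h)) = ?l (L (1, 0)) * h" for h
    proof -
      have "?l (L (Re h, Im h)) = Re h *\<^sub>R ?l (L (1, 0)) + Im h *\<^sub>R (\<i> * ?l (L (1, 0)))"
        by (subst L_eq)
           (simp add: L01 linear_add[OF bounded_linear.linear[OF bounded_linear_slice_functional]]
             linear_scale[OF bounded_linear.linear[OF bounded_linear_slice_functional]]
             slice_functional_imag_mult[OF I])
      then show ?thesis by (simp add: complex_eq_iff algebra_simps)
    qed
    ultimately show ?thesis by (simp add: has_field_derivative_def)
  qed
  note deriv = this
  show ?thesis
    unfolding holomorphic_on_def
  proof
    fix z assume z: "z \<in> D"
    then have "?g differentiable (at (Re z, Im z))"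
      using f I D(2)[OF z] unfolding slice_regular_on_def by blast
    then obtain L where "(?g has_derivative L) (at (Re z, Im z))"
      unfolding differentiable_def by blast
    from deriv[OF z this]
    show "(\<lambda>z. ?l (f (slice_pt I (Re z) (Im z)))) field_differentiable (at z within D)"
      unfolding field_differentiable_def by (blast intro: has_field_derivative_at_within)
  qed
qed

text \<open>\<open>b + \<i> c\<close> is a holomorphic map into the complexified quaternions.\<close>

definition holomorphic_stem :: "(complex \<Rightarrow> quat) \<Rightarrow> (complex \<Rightarrow> quat) \<Rightarrow> complex set \<Rightarrow> bool" where
  "holomorphic_stem b c D \<longleftrightarrow> (\<forall>v. (\<lambda>z. Complex (b z \<bullet> v) (c z \<bullet> v)) holomorphic_on D)"

text \<open>All slices are compared with that of \<open>J\<close>. They share the real axis, and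
  axial symmetry gives them the same parameter domain \<open>D\<close>, so the identity theorem
  carries agreement on the axis to all of \<open>D\<close>.\<close>

theorem slice_representation:
  assumes \<Omega>: "symmetric_slice_domain \<Omega>" and f: "slice_regular_on f \<Omega>"
  obtains D b c where "open D" "holomorphic_stem b c D"
    "\<And>I z. I \<in> unit_imag \<Longrightarrow> slice_pt I (Re z) (Im z) \<in> \<Omega> \<longleftrightarrow> z \<in> D"
    "\<And>I z. I \<in> unit_imag \<Longrightarrow> z \<in> D \<Longrightarrow> f (slice_pt I (Re z) (Im z)) = b z + I * c z"
proof -
  \<comment> \<open>With the unit i, the slice is read off by the coordinates \<open>qRe\<close> and
    \<open>qI\<close>, which is convenient for transferring connectedness to
    \<open>D\<close>.\<close>
  define J where "J = Quat 0 1 0 0"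
  have J: "J \<in> unit_imag" by (simp add: J_def unit_imag_iff)
  define D where "D = {z. slice_pt J (Re z) (Im z) \<in> \<Omega>}"
  have D_iff: "slice_pt I (Re z) (Im z) \<in> \<Omega> \<longleftrightarrow> z \<in> D" if "I \<in> unit_imag" for I z
    using \<Omega> J that unfolding symmetric_slice_domain_def axially_symmetric_def D_def by blast
  have D_cnj: "cnj z \<in> D" if "z \<in> D" for z
  proof -
    have "slice_pt (-J) (Re z) (Im z) = slice_pt J (Re (cnj z)) (Im (cnj z))"
      by (simp add: slice_pt_def)
    then show ?thesis using that D_iff[OF unit_imagD(6)[OF J]] D_iff[OF J] by metis
  qed
  have "continuous_on UNIV (\<lambda>z. slice_pt J (Re z) (Im z))"
    unfolding slice_pt_def by (intro continuous_intros)
  then have "open ((\<lambda>z. slice_pt J (Re z) (Im z)) -` \<Omega>)"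
    using \<Omega> by (intro open_vimage) (auto simp: symmetric_slice_domain_def)
  then have D_open: "open D" by (simp add: D_def vimage_def)
  have D_conn: "connected D"
  proof -
    have "D = (\<lambda>q. Complex (qRe q) (qI q)) ` (\<Omega> \<inter> slice J)"
      by (force simp: D_def slice_def slice_pt_def J_def)
    moreover have "continuous_on (\<Omega> \<inter> slice J) (\<lambda>q. Complex (qRe q) (qI q))"
      unfolding Complex_eq
      by (intro continuous_intros linear_continuous_on bounded_linear_quat_sel)
    ultimately show ?thesis
      using \<Omega> J by (auto simp: symmetric_slice_domain_def intro: connected_continuous_image)
  qed
  obtain x where x: "of_real x \<in> \<Omega>"
    using \<Omega> by (auto simp: symmetric_slice_domain_def Reals_def)
  then have xD: "of_real x \<in> D" by (simp add: D_def slice_pt_def)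
  \<comment> \<open>The identity theorem needs accumulating zeros. They are real, and this is where
    the domain meeting the real axis matters.\<close>
  have lim: "complex_of_real x islimpt D \<inter> \<real>"
  proof (rule islimptI)
    fix T assume T: "complex_of_real x \<in> T" "open T"
    then obtain e where e: "e > 0" "ball (complex_of_real x) e \<subseteq> T \<inter> D"
      using xD D_open by (meson IntI open_Int openE)
    moreover have "complex_of_real (x + e/2) \<in> ball (complex_of_real x) e"
      using e(1) by (simp add: dist_norm)
    ultimately show "\<exists>y\<in>D \<inter> \<real>. y \<in> T \<and> y \<noteq> complex_of_real x"
      by (intro bexI[of _ "complex_of_real (x + e/2)"])
        (auto simp del: of_real_add of_real_divide)
  qed
  define g where "g = (\<lambda>z. f (slice_pt J (Re z) (Im z)))"
  \<comment> \<open>Solution of \<open>b z + J * c z = g z\<close> and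
    \<open>b z - J * c z = g (cnj z)\<close>: the point over \<open>cnj z\<close> in direction
    \<open>J\<close> is the point over \<open>z\<close> in direction \<open>- J\<close>.\<close>
  define b where "b = (\<lambda>z. (g z + g (cnj z)) /\<^sub>R 2)"
  define c where "c = (\<lambda>z. - J * (g z - g (cnj z)) /\<^sub>R 2)"
  \<comment> \<open>Paired with \<open>v\<close>, the stem is the mean of a holomorphic function and
    its Schwarz reflection; hence its holomorphy.\<close>
  have bc_eq: "Complex (b z \<bullet> v) (c z \<bullet> v) =
      (slice_functional J v (g z) + cnj (slice_functional J v (g (cnj z)))) / 2" for z v
    using unit_imagD(1)[OF J]
    by (simp add: b_def c_def slice_functional_def complex_eq_iff inner_imag_mult_left
        inner_add_left inner_diff_left) (simp add: field_simps)
  have hol: "(\<lambda>z. slice_functional I v (f (slice_pt I (Re z) (Im z)))) holomorphic_on D"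
    if "I \<in> unit_imag" for I v
    using slice_regular_holomorphic[OF f that D_open] D_iff[OF that] by simp
  have stem: "holomorphic_stem b c D"
    unfolding holomorphic_stem_def bc_eq
  proof (intro allI holomorphic_intros)
    fix v
    show g: "(\<lambda>z. slice_functional J v (g z)) holomorphic_on D"
      using hol[OF J] by (simp add: g_def)
    have "cnj ` D = D" using D_cnj by (metis complex_cnj_cnj image_eqI image_subsetI subsetI subset_antisym)
    then show "(\<lambda>z. cnj (slice_functional J v (g (cnj z)))) holomorphic_on D"
      using g D_open holomorphic_on_compose_cnj_cnj[of "\<lambda>z. slice_functional J v (g z)" D]
      by (simp add: o_def)
  qed simp
  text \<open>Both sides of \<open>key\<close> are holomorphic on the connected set \<open>D\<close> and agree on the real axis;
    its real part is the representation formula paired with \<open>v\<close>.\<close>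
  have rep: "f (slice_pt I (Re w) (Im w)) = b w + I * c w" if I: "I \<in> unit_imag" and w: "w \<in> D" for I w
  proof -
    have key: "slice_functional I v (f (slice_pt I (Re w) (Im w))) =
        Complex (b w \<bullet> v) (c w \<bullet> v) + \<i> * Complex (b w \<bullet> (I * v)) (c w \<bullet> (I * v))" for v
    proof -
      let ?h = "\<lambda>z. slice_functional I v (f (slice_pt I (Re z) (Im z))) -
        (Complex (b z \<bullet> v) (c z \<bullet> v) + \<i> * Complex (b z \<bullet> (I * v)) (c z \<bullet> (I * v)))"
      have "?h w = 0"
      proof (rule analytic_continuation[OF _ D_open D_conn _ xD lim _ w, of ?h])
        show "?h holomorphic_on D"
          using stem unfolding holomorphic_stem_def
          by (intro holomorphic_intros hol[OF I]) auto
        show "?h z = 0" if "z \<in> D \<inter> \<real>" for z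
        proof -
          have z: "Im z = 0" "cnj z = z" using that by (auto simp: complex_is_Real_iff complex_eq_iff)
          then have "b z = f (of_real (Re z))" "c z = 0"
            by (simp_all add: b_def c_def g_def slice_pt_def)
          then show ?thesis
            using z by (simp add: slice_functional_def slice_pt_def complex_eq_iff)
        qed
      qed auto
      then show ?thesis by simp
    qed
    have "f (slice_pt I (Re w) (Im w)) \<bullet> v = (b w + I * c w) \<bullet> v" for v
      using arg_cong[OF key[of v], of Re] unit_imagD(1)[OF I]
      by (simp add: slice_functional_def inner_add_left inner_imag_mult_left)
    then show ?thesis using vector_eq_rdot by blast
  qed
  show thesis
    by (rule that[OF D_open stem D_iff rep])
qed

text \<open>For \<open>F = b + \<i> c\<close> with complex derivative \<open>b' + \<i> c'\<close>,
  the differentials of \<open>b\<close> and \<open>c\<close> are the real and imaginary parts of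
  that derivative times \<open>h\<close>. It is computed in coordinates, where \<open>F\<close>
  consists of ordinary holomorphic functions.\<close>

lemma holomorphic_stem_derivative:
  assumes D: "open D" and bc: "holomorphic_stem b c D"
  obtains b' c' where "holomorphic_stem b' c' D"
    "\<And>z. z \<in> D \<Longrightarrow> (b has_derivative (\<lambda>h. Re h *\<^sub>R b' z - Im h *\<^sub>R c' z)) (at z)"
    "\<And>z. z \<in> D \<Longrightarrow> (c has_derivative (\<lambda>h. Im h *\<^sub>R b' z + Re h *\<^sub>R c' z)) (at z)"
    "\<And>v z. z \<in> D \<Longrightarrow>
      ((\<lambda>z. Complex (b z \<bullet> v) (c z \<bullet> v)) has_field_derivative Complex (b' z \<bullet> v) (c' z \<bullet> v)) (at z)"
proof -
  define F where "F = (\<lambda>v z. Complex (b z \<bullet> v) (c z \<bullet> v))"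
  have F: "F v holomorphic_on D" for v
    using bc by (simp add: holomorphic_stem_def F_def)
  define b' where "b' = (\<lambda>z. \<Sum>e\<in>Basis. Re (deriv (F e) z) *\<^sub>R e)"
  define c' where "c' = (\<lambda>z. \<Sum>e\<in>Basis. Im (deriv (F e) z) *\<^sub>R e)"
  have dF: "(F v has_derivative (\<lambda>h. deriv (F v) z * h)) (at z)" if "z \<in> D" for v z
    using holomorphic_derivI[OF F D that, of v UNIV] by (simp add: has_field_derivative_def)
  have b: "b z = (\<Sum>e\<in>Basis. Re (F e z) *\<^sub>R e)" and c: "c z = (\<Sum>e\<in>Basis. Im (F e z) *\<^sub>R e)" for z
    by (simp_all add: F_def euclidean_representation)
  have db: "(b has_derivative (\<lambda>h. Re h *\<^sub>R b' z - Im h *\<^sub>R c' z)) (at z)" if "z \<in> D" for z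
  proof -
    have "(b has_derivative (\<lambda>h. \<Sum>e\<in>Basis. Re (deriv (F e) z * h) *\<^sub>R e)) (at z)"
      unfolding b[abs_def] by (intro has_derivative_sum has_derivative_scaleR_left
          bounded_linear.has_derivative[OF bounded_linear_Re] dF that)
    moreover have "(\<Sum>e\<in>Basis. Re (deriv (F e) z * h) *\<^sub>R e) = Re h *\<^sub>R b' z - Im h *\<^sub>R c' z" for h
      by (simp add: b'_def c'_def scaleR_sum_right scaleR_diff_left sum_subtractf mult.commute)
    ultimately show ?thesis by simp
  qed
  have dc: "(c has_derivative (\<lambda>h. Im h *\<^sub>R b' z + Re h *\<^sub>R c' z)) (at z)" if "z \<in> D" for z
  proof -
    have "(c has_derivative (\<lambda>h. \<Sum>e\<in>Basis. Im (deriv (F e) z * h) *\<^sub>R e)) (at z)"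
      unfolding c[abs_def] by (intro has_derivative_sum has_derivative_scaleR_left
          bounded_linear.has_derivative[OF bounded_linear_Im] dF that)
    moreover have "(\<Sum>e\<in>Basis. Im (deriv (F e) z * h) *\<^sub>R e) = Im h *\<^sub>R b' z + Re h *\<^sub>R c' z" for h
      by (simp add: b'_def c'_def scaleR_sum_right scaleR_add_left sum.distrib mult.commute add.commute)
    ultimately show ?thesis by simp
  qed
  have dFv: "((\<lambda>z. Complex (b z \<bullet> v) (c z \<bullet> v)) has_field_derivative Complex (b' z \<bullet> v) (c' z \<bullet> v)) (at z)"
    if "z \<in> D" for v z
  proof -
    have "((\<lambda>z. of_real (b z \<bullet> v) + \<i> * of_real (c z \<bullet> v)) has_derivative
        (\<lambda>h. of_real ((Re h *\<^sub>R b' z - Im h *\<^sub>R c' z) \<bullet> v) +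
          \<i> * of_real ((Im h *\<^sub>R b' z + Re h *\<^sub>R c' z) \<bullet> v))) (at z)"
      by (intro derivative_intros db dc that)
    moreover have "of_real ((Re h *\<^sub>R b' z - Im h *\<^sub>R c' z) \<bullet> v) +
        \<i> * of_real ((Im h *\<^sub>R b' z + Re h *\<^sub>R c' z) \<bullet> v) = Complex (b' z \<bullet> v) (c' z \<bullet> v) * h" for h
      by (simp add: complex_eq_iff inner_simps algebra_simps)
    ultimately show ?thesis by (simp add: has_field_derivative_def Complex_eq)
  qed
  have "(\<lambda>z. Complex (b' z \<bullet> v) (c' z \<bullet> v)) holomorphic_on D" for v
  proof (rule holomorphic_transform[OF holomorphic_deriv[OF F D]])
    show "deriv (F v) z = Complex (b' z \<bullet> v) (c' z \<bullet> v)" if "z \<in> D" for z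
      using DERIV_imp_deriv[OF dFv[OF that, of v]] by (simp add: F_def)
  qed
  then have "holomorphic_stem b' c' D"
    by (simp add: holomorphic_stem_def)
  with db dc dFv that show thesis by blast
qed

lemma holomorphic_stem_C_k_on:
  assumes D: "open D" and bc: "holomorphic_stem b c D"
  shows "C_k_on k b D" "C_k_on k c D"
proof -
  have F: "C_k_on k (\<lambda>z. Complex (b z \<bullet> v) (c z \<bullet> v)) D" for v
    using bc by (intro holomorphic_on_imp_C_k_on D) (simp add: holomorphic_stem_def)
  show "C_k_on k b D" "C_k_on k c D"
    using C_k_on_linear_comp[OF D bounded_linear_Re F] C_k_on_linear_comp[OF D bounded_linear_Im F]
    by (auto intro: C_k_on_componentwise[OF D])
qed


section \<open>Injectivity and the differential\<close>

text \<open>Unless \<open>f\<close> is constant, it equals \<open>h ^ n\<close> near the zero with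
  \<open>n\<close> at least 2 and \<open>h\<close> open. The values \<open>e/2\<close> and
  \<open>e/2 * \<omega>\<close> of \<open>h\<close>, with \<open>\<omega>\<close> a nontrivial n-th
  root of unity, then have the same real n-th power.\<close>

lemma holomorphic_equal_real_values:
  assumes hol: "f holomorphic_on ball \<xi> r" and r: "r > 0" and f0: "f \<xi> = 0" and df0: "deriv f \<xi> = 0"
  obtains z w t where "z \<in> ball \<xi> r" "w \<in> ball \<xi> r" "z \<noteq> w" "f z = complex_of_real t" "f w = complex_of_real t"
proof (cases "\<forall>n>0. (deriv ^^ n) f \<xi> = 0")
  case True
  define w where "w = \<xi> + of_real (r/2)"
  have w: "w \<in> ball \<xi> r" "\<xi> \<noteq> w" using r by (simp_all add: w_def dist_norm)
  then have "f w = f \<xi>"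
    using holomorphic_fun_eq_const_on_connected[OF hol open_ball connected_ball, of \<xi> w] True r by simp
  with that[of \<xi> w 0] w r f0 show thesis by simp
next
  case False
  define n where "n = (LEAST n. n > 0 \<and> (deriv ^^ n) f \<xi> \<noteq> 0)"
  from False have n: "n > 0" "(deriv ^^ n) f \<xi> \<noteq> 0"
    using LeastI_ex[of "\<lambda>n. n > 0 \<and> (deriv ^^ n) f \<xi> \<noteq> 0"] by (auto simp: n_def)
  have "(deriv ^^ i) f \<xi> = 0" if "0 < i" "i < n" for i
    using that not_less_Least[of i "\<lambda>n. n > 0 \<and> (deriv ^^ n) f \<xi> \<noteq> 0"] by (auto simp: n_def)
  then obtain g s where s: "s > 0" and g: "g holomorphic_on ball \<xi> s"
    and fg: "\<And>w. w \<in> ball \<xi> s \<Longrightarrow> f w - f \<xi> = ((w - \<xi>) * g w) ^ n"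
    and gnz: "\<And>w. w \<in> ball \<xi> s \<Longrightarrow> g w \<noteq> 0"
    using holomorphic_factor_order_of_zero_strong[OF hol open_ball _ n] r by (metis centre_in_ball)
  have n2: "n \<ge> 2"
  proof (rule ccontr)
    assume "\<not> n \<ge> 2"
    then have "n = 1" using n(1) by simp
    then show False using n(2) df0 by simp
  qed
  define B where "B = ball \<xi> (min r s)"
  define h where "h = (\<lambda>w. (w - \<xi>) * g w)"
  have h: "h holomorphic_on B"
    unfolding h_def B_def by (intro holomorphic_intros holomorphic_on_subset[OF g]) auto
  have "\<xi> \<in> B" using r s by (simp add: B_def)
  have "\<not> h constant_on B"
  proof
    assume "h constant_on B"
    moreover define w where "w = \<xi> + of_real (min r s / 2)"
    have w: "w \<in> B" "w \<noteq> \<xi>" using r s by (simp_all add: w_def B_def dist_norm min_def)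
    ultimately have "h w = h \<xi>" using \<open>\<xi> \<in> B\<close> by (auto simp: constant_on_def)
    then show False using w gnz[of w] by (simp add: h_def B_def)
  qed
  then have "open (h ` B)"
    by (intro open_mapping_thm[OF h]) (auto simp: B_def)
  moreover have "0 \<in> h ` B" using \<open>\<xi> \<in> B\<close> by (auto simp: h_def image_iff)
  ultimately obtain e where e: "e > 0" "ball 0 e \<subseteq> h ` B" by (meson openE)
  define \<omega> where "\<omega> = cis (2 * pi / n)"
  have \<omega>n: "\<omega> ^ n = 1" using n(1) by (simp add: \<omega>_def Complex.DeMoivre cis_2pi)
  have \<omega>1: "\<omega> \<noteq> 1"
  proof
    assume "\<omega> = 1"
    then have "cos (2 * pi / n) = 1" by (simp add: \<omega>_def complex_eq_iff)
    moreover have "0 < 2 * pi / n" "2 * pi / n \<le> pi" using n2 by (simp_all add: field_simps)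
    ultimately show False using cos_monotone_0_pi[of 0 "2 * pi / n"] by simp
  qed
  have "of_real (e/2) \<in> h ` B" "of_real (e/2) * \<omega> \<in> h ` B"
    using e by (auto simp: norm_mult \<omega>_def intro!: subsetD[OF e(2)])
  then obtain z w where z: "z \<in> B" "h z = of_real (e/2)" and w: "w \<in> B" "h w = of_real (e/2) * \<omega>"
    by (metis imageE)
  have "f z = h z ^ n" "f w = h w ^ n"
    using fg[of z] fg[of w] z(1) w(1) f0 by (simp_all add: B_def h_def)
  then have "f z = of_real ((e/2) ^ n)" "f w = of_real ((e/2) ^ n)"
    unfolding z(2) w(2) by (simp_all only: power_mult_distrib \<omega>n mult_1_right of_real_power)
  moreover have "z \<noteq> w" using z w \<omega>1 e(1) by auto
  ultimately show thesis
    using that[of z w "(e/2) ^ n"] z w by (simp add: B_def)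
qed

text \<open>The complex-bilinear (not Hermitian) extension of the inner product to the complexified
  space. Bilinearity keeps such sums holomorphic.\<close>

lemma sum_Basis_Complex_mult:
  "(\<Sum>e\<in>Basis. Complex (x \<bullet> e) (y \<bullet> e) * Complex (u \<bullet> e) (w \<bullet> e)) =
    Complex (x \<bullet> u - y \<bullet> w) (x \<bullet> w + y \<bullet> u)"
  by (simp add: complex_eq_iff sum_subtractf sum.distrib flip: euclidean_inner)

text \<open>The value \<open>m\<close> is taken on the sphere over \<open>z\<close> iff \<open>\<Sum>e. (F\<^sub>e z - m\<^sub>e)\<^sup>2 = 0\<close>, where
  \<open>F = b + \<i> c\<close>. For \<open>m = p + t k\<close> this reads \<open>P - 2 t Q + t\<^sup>2 = 0\<close>, and near \<open>z0\<close> it is solved by a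
  holomorphic function \<open>t = \<tau> z\<close>. If the differential were singular, \<open>\<tau>\<close> would have a multiple
  zero at \<open>z0\<close>, hence take some real value twice, and \<open>f\<close> would not be injective.\<close>

lemma stem_nonsingular:
  assumes U: "open U" and bc: "holomorphic_stem b c U"
    and deriv: "\<And>v z. z \<in> U \<Longrightarrow>
      ((\<lambda>z. Complex (b z \<bullet> v) (c z \<bullet> v)) has_field_derivative Complex (b' z \<bullet> v) (c' z \<bullet> v)) (at z)"
    and inj: "\<And>z w I J. z \<in> U \<Longrightarrow> w \<in> U \<Longrightarrow> I \<in> unit_imag \<Longrightarrow> J \<in> unit_imag \<Longrightarrow>
      b z + I * c z = b w + J * c w \<Longrightarrow> z = w \<and> I = J"
    and z0: "z0 \<in> U" and I: "I \<in> unit_imag"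
  shows "c z0 \<noteq> 0" and "slice_proj I ((b' z0 + I * c' z0) * inverse (c z0)) \<noteq> 0"
proof -
  have c_nz: "c z \<noteq> 0" if "z \<in> U" for z
  proof
    assume "c z = 0"
    define J where "J = Quat 0 1 0 0"
    have J: "J \<in> unit_imag" by (simp add: J_def unit_imag_iff)
    have "J = - J" using inj[OF that that J unit_imagD(6)[OF J]] \<open>c z = 0\<close> by simp
    then show False by (simp add: J_def quat_eq_iff)
  qed
  show cz0: "c z0 \<noteq> 0" by (rule c_nz[OF z0])
  define A where "A = b' z0 + I * c' z0"
  show "slice_proj I (A * inverse (c z0)) \<noteq> 0"
  proof
    assume "slice_proj I (A * inverse (c z0)) = 0"
    then have A: "A \<bullet> c z0 = 0" "A \<bullet> (I * c z0) = 0"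
      using slice_proj_mult_inverse_eq_0_iff[OF I cz0] by auto
    define p where "p = b z0 + I * c z0"
    \<comment> \<open>The direction of \<open>c z0\<close> makes the imaginary part of
      \<open>Q z0\<close> equal to the length of \<open>c z0\<close>, hence nonzero, so
      \<open>Q\<close> can be divided by near \<open>z0\<close>; unit length makes the quadratic in
      \<open>t\<close> monic.\<close>
    define k where "k = c z0 /\<^sub>R norm (c z0)"
    have k: "k \<bullet> k = 1" using cz0 by (simp add: k_def flip: power2_norm_eq_inner)
    define P where "P = (\<lambda>z. \<Sum>e\<in>Basis. Complex ((b z - p) \<bullet> e) (c z \<bullet> e) * Complex ((b z - p) \<bullet> e) (c z \<bullet> e))"
    define Q where "Q = (\<lambda>z. Complex ((b z - p) \<bullet> k) (c z \<bullet> k))"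
    have P_eq: "P z = Complex ((b z - p) \<bullet> (b z - p) - c z \<bullet> c z) (2 * ((b z - p) \<bullet> c z))" for z
      by (simp add: P_def sum_Basis_Complex_mult inner_commute[of "c z" "b z - p"])
    have F: "((\<lambda>z. Complex ((b z - p) \<bullet> v) (c z \<bullet> v)) has_field_derivative
        Complex (b' z \<bullet> v) (c' z \<bullet> v)) (at z)" if "z \<in> U" for z v
    proof -
      have "Complex ((b z - p) \<bullet> v) (c z \<bullet> v) = Complex (b z \<bullet> v) (c z \<bullet> v) - of_real (p \<bullet> v)" for z
        by (simp add: complex_eq_iff inner_diff_left)
      then show ?thesis
        using DERIV_diff[OF deriv[OF that, of v] DERIV_const, of "of_real (p \<bullet> v)"] by simp
    qed
    have Q_hol: "Q holomorphic_on U"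
      unfolding Q_def by (rule holomorphic_on_open[THEN iffD2, OF U]) (use F in blast)
    have P_hol: "P holomorphic_on U"
      unfolding P_def
      by (intro holomorphic_intros; rule holomorphic_on_open[THEN iffD2, OF U]; use F in blast)
    have bp: "b z0 - p = - (I * c z0)" by (simp add: p_def)
    have P0: "P z0 = 0"
      using inner_imag_mult_left[of I "c z0" "c z0"] unit_imagD(1)[OF I]
      by (simp add: P_eq bp inner_unit_imag_mult[OF I] inner_commute complex_eq_iff)
    have "(P has_field_derivative (\<Sum>e\<in>Basis. 2 * (Complex ((b z0 - p) \<bullet> e) (c z0 \<bullet> e) *
        Complex (b' z0 \<bullet> e) (c' z0 \<bullet> e)))) (at z0)"
      unfolding P_def by (rule DERIV_sum) (auto intro!: derivative_eq_intros F z0)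
    \<comment> \<open>The derivative of \<open>P\<close> consists of exactly the two inner products
      that vanish when the differential is singular.\<close>
    moreover have "(\<Sum>e\<in>Basis. 2 * (Complex ((b z0 - p) \<bullet> e) (c z0 \<bullet> e) *
        Complex (b' z0 \<bullet> e) (c' z0 \<bullet> e))) = 2 * Complex (- (A \<bullet> (I * c z0))) (A \<bullet> c z0)"
    proof -
      have "(I * c z0) \<bullet> (I * c' z0) = c z0 \<bullet> c' z0" by (rule inner_unit_imag_mult[OF I])
      moreover have "(I * c z0) \<bullet> c' z0 = - (c z0 \<bullet> (I * c' z0))"
        by (rule inner_imag_mult_left[OF unit_imagD(1)[OF I]])
      ultimately show ?thesis
        unfolding sum_distrib_left[symmetric] sum_Basis_Complex_mult bp A_def
        by (simp add: inner_add_left inner_add_right inner_commute)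
    qed
    moreover have "2 * Complex (- (A \<bullet> (I * c z0))) (A \<bullet> c z0) = 0"
      using A by (simp add: complex_eq_iff)
    ultimately have P1: "(P has_field_derivative 0) (at z0)" by metis
    have Q0: "Q z0 \<noteq> 0"
    proof -
      have "c z0 \<bullet> k = norm (c z0)"
        using cz0 by (simp add: k_def power2_eq_square flip: power2_norm_eq_inner)
      then show ?thesis using cz0 by (simp add: Q_def complex_eq_iff)
    qed
    define S where "S = {z\<in>U. Q z \<noteq> 0}"
    have S: "open S"
    proof -
      have "S = U \<inter> Q -` (- {0})" by (auto simp: S_def)
      then show ?thesis
        using continuous_open_preimage[OF holomorphic_on_imp_continuous_on[OF Q_hol] U, of "- {0}"]
        by (simp add: open_Compl)
    qed
    have R_hol: "(\<lambda>z. P z / (Q z)\<^sup>2) holomorphic_on S"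
      by (intro holomorphic_intros holomorphic_on_subset[OF P_hol] holomorphic_on_subset[OF Q_hol])
        (auto simp: S_def)
    have "open (S \<inter> (\<lambda>z. P z / (Q z)\<^sup>2) -` ball 0 1)"
      by (rule continuous_open_preimage[OF holomorphic_on_imp_continuous_on[OF R_hol] S open_ball])
    moreover have "z0 \<in> S \<inter> (\<lambda>z. P z / (Q z)\<^sup>2) -` ball 0 1"
      using z0 Q0 P0 by (simp add: S_def)
    ultimately obtain r where r: "r > 0" "ball z0 r \<subseteq> S \<inter> (\<lambda>z. P z / (Q z)\<^sup>2) -` ball 0 1"
      by (meson openE)
    have ball: "z \<in> U" "Q z \<noteq> 0" "norm (P z / (Q z)\<^sup>2) < 1" if "z \<in> ball z0 r" for z
      using subsetD[OF r(2) that] by (auto simp: S_def)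
    \<comment> \<open>Dividing the discriminant by \<open>(Q z)\<^sup>2\<close> puts the radicand
      within distance 1 of 1, away from the branch cut of \<open>csqrt\<close>.\<close>
    define s where "s = (\<lambda>z. csqrt (1 - P z / (Q z)\<^sup>2))"
    have s_hol: "s holomorphic_on ball z0 r"
      unfolding s_def
    proof (rule holomorphic_on_csqrt')
      show "(\<lambda>z. 1 - P z / (Q z)\<^sup>2) holomorphic_on ball z0 r"
        using r(2) by (intro holomorphic_intros holomorphic_on_subset[OF R_hol]) auto
      show "1 - P z / (Q z)\<^sup>2 \<notin> \<real>\<^sub>\<le>\<^sub>0" if "z \<in> ball z0 r" for z
        using ball(3)[OF that] complex_Re_le_cmod[of "P z / (Q z)\<^sup>2"]
        by (auto simp: complex_nonpos_Reals_iff simp del: norm_divide)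
    qed
    have s1: "1 + s z \<noteq> 0" for z
    proof
      assume "1 + s z = 0"
      then have "Re (s z) = -1" by (simp add: complex_eq_iff)
      moreover have "Re (s z) \<ge> 0" unfolding s_def by (rule Re_csqrt)
      ultimately show False by simp
    qed
    \<comment> \<open>The root \<open>Q z * (1 - s z)\<close> of the quadratic, rationalised: with
      \<open>P\<close> as a factor, the multiple zero of \<open>P\<close> passes visibly to
      \<open>\<tau>\<close>.\<close>
    define \<tau> where "\<tau> = (\<lambda>z. P z * inverse (Q z * (1 + s z)))"
    have inv_hol: "(\<lambda>z. inverse (Q z * (1 + s z))) holomorphic_on ball z0 r"
      using ball s1 by (intro holomorphic_intros s_hol holomorphic_on_subset[OF Q_hol]) auto
    have "\<tau> holomorphic_on ball z0 r"
      unfolding \<tau>_def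
      using ball by (intro holomorphic_intros inv_hol holomorphic_on_subset[OF P_hol]) auto
    moreover have "\<tau> z0 = 0" by (simp add: \<tau>_def P0)
    moreover have "deriv \<tau> z0 = 0"
    proof -
      obtain d where "((\<lambda>z. inverse (Q z * (1 + s z))) has_field_derivative d) (at z0)"
        using inv_hol r(1) holomorphic_on_open[OF open_ball] by (metis centre_in_ball)
      from DERIV_mult[OF P1 this] show ?thesis
        by (intro DERIV_imp_deriv) (simp add: \<tau>_def P0)
    qed
    ultimately obtain z w t where zw: "z \<in> ball z0 r" "w \<in> ball z0 r" "z \<noteq> w"
      and t: "\<tau> z = of_real t" "\<tau> w = of_real t"
      using holomorphic_equal_real_values[OF _ r(1)] by metis
    have hit: "\<exists>J\<in>unit_imag. b x + J * c x = p + t *\<^sub>R k" if x: "x \<in> ball z0 r" and t: "\<tau> x = of_real t" for x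
    proof -
      have ss: "(s x)\<^sup>2 = 1 - P x / (Q x)\<^sup>2" by (simp add: s_def)
      then have P: "P x = (Q x)\<^sup>2 * (1 - s x) * (1 + s x)"
        using ball(2)[OF x] by (simp add: field_simps power2_eq_square)
      have "\<tau> x = Q x * (1 - s x) * ((Q x * (1 + s x)) * inverse (Q x * (1 + s x)))"
        unfolding \<tau>_def P by (simp only: power2_eq_square mult_ac)
      also have "(Q x * (1 + s x)) * inverse (Q x * (1 + s x)) = 1"
        using ball(2)[OF x] s1[of x] by (intro right_inverse) simp
      finally have "\<tau> x = Q x * (1 - s x)" by simp
      then have "P x - 2 * of_real t * Q x + (of_real t)\<^sup>2 = 0"
        unfolding P t[symmetric] by algebra
      \<comment> \<open>Reality of \<open>t\<close> is what allows the complex equation to be split: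
        its real part gives the length and its imaginary part the orthogonality required of
        \<open>p + t *\<^sub>R k - b x\<close>.\<close>
      then have "(b x - p) \<bullet> (b x - p) - c x \<bullet> c x - 2 * t * ((b x - p) \<bullet> k) + t\<^sup>2 = 0"
        "2 * ((b x - p) \<bullet> c x) - 2 * t * (c x \<bullet> k) = 0"
        by (simp_all add: complex_eq_iff P_eq Q_def power2_eq_square)
      then have "(p + t *\<^sub>R k - b x) \<bullet> (p + t *\<^sub>R k - b x) = c x \<bullet> c x" "(p + t *\<^sub>R k - b x) \<bullet> c x = 0"
        by (simp_all add: inner_add_left inner_add_right inner_diff_left inner_diff_right k
            inner_commute power2_eq_square algebra_simps)
      from exists_unit_imag_mult[OF c_nz[OF ball(1)[OF x]] this]
      show ?thesis by (metis add.commute diff_add_cancel)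
    qed
    then show False
      using hit[OF zw(1) t(1)] hit[OF zw(2) t(2)] inj[OF ball(1)[OF zw(1)] ball(1)[OF zw(2)]] zw(3) by metis
  qed
qed


section \<open>Smoothness off the real axis and charts\<close>

definition slice_coord :: "quat \<Rightarrow> complex" where
  "slice_coord q = Complex (qRe q) (norm (quat_Im q))"

lemma has_derivative_norm_quat_Im:
  assumes "q \<notin> \<real>"
  shows "((\<lambda>q. norm (quat_Im q)) has_derivative (\<lambda>h. imag_dir q \<bullet> h)) (at q)"
proof -
  have "((\<lambda>q. norm (quat_Im q)) has_derivative (\<lambda>h. sgn (quat_Im q) \<bullet> quat_Im h)) (at q)"
    using has_derivative_compose[OF bounded_linear_imp_has_derivative[OF bounded_linear_quat_Im]
        has_derivative_norm[of "quat_Im q"]] assms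
    by (simp add: quat_Im_eq_0_iff inner_commute)
  moreover have "sgn (quat_Im q) \<bullet> quat_Im h = imag_dir q \<bullet> h" for h
    by (simp add: sgn_div_norm imag_dir_def inner_quat_def)
  ultimately show ?thesis by simp
qed

lemma has_derivative_Complex:
  assumes "(f has_derivative f') F" "(g has_derivative g') F"
  shows "((\<lambda>x. Complex (f x) (g x)) has_derivative (\<lambda>h. Complex (f' h) (g' h))) F"
  unfolding Complex_eq by (intro derivative_intros assms)

lemma has_derivative_slice_coord:
  assumes "q \<notin> \<real>"
  shows "(slice_coord has_derivative (\<lambda>h. Complex (qRe h) (imag_dir q \<bullet> h))) (at q)"
  unfolding slice_coord_def[abs_def]
  by (intro has_derivative_Complex has_derivative_norm_quat_Im assms
      bounded_linear_imp_has_derivative bounded_linear_quat_sel)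

text \<open>Moving within the slice fixes the direction, while moving orthogonally turns it at rate
  one over the distance to the real axis. This is the origin of the divisor in the spherical
  derivative.\<close>

lemma has_derivative_imag_dir:
  assumes q: "q \<notin> \<real>"
  shows "(imag_dir has_derivative (\<lambda>h. (h - slice_proj (imag_dir q) h) /\<^sub>R norm (quat_Im q))) (at q)"
proof -
  define r where "r = norm (quat_Im q)"
  have r: "r \<noteq> 0" using q by (simp add: r_def quat_Im_eq_0_iff)
  have "((\<lambda>q. inverse (norm (quat_Im q)) *\<^sub>R quat_Im q) has_derivative
      (\<lambda>h. inverse r *\<^sub>R quat_Im h + (- (inverse r * (imag_dir q \<bullet> h) * inverse r)) *\<^sub>R quat_Im q)) (at q)"
    unfolding r_def
    by (rule has_derivative_scaleR[OF Deriv.has_derivative_inverse[OF _ has_derivative_norm_quat_Im[OF q]]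
          bounded_linear_imp_has_derivative[OF bounded_linear_quat_Im]])
       (use q in \<open>simp add: quat_Im_eq_0_iff\<close>)
  moreover have "inverse r *\<^sub>R quat_Im h + (- (inverse r * (imag_dir q \<bullet> h) * inverse r)) *\<^sub>R quat_Im q =
      (h - slice_proj (imag_dir q) h) /\<^sub>R r" for h
  proof -
    have "quat_Im q = r *\<^sub>R imag_dir q" using r by (simp add: imag_dir_def r_def)
    then show ?thesis
      using r by (simp add: slice_proj_def quat_Im_def[of h] scaleR_diff_right algebra_simps)
  qed
  ultimately show ?thesis by (simp add: imag_dir_def[abs_def] r_def)
qed

lemma slice_pt_slice_coord:
  assumes "q \<notin> \<real>"
  shows "slice_pt (imag_dir q) (Re (slice_coord q)) (Im (slice_coord q)) = q" "Im (slice_coord q) > 0"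
  using assms slice_pt_imag_dir[OF assms] by (simp_all add: slice_coord_def quat_Im_eq_0_iff)

text \<open>Here \<open>B\<close> and \<open>C\<close> are the derivatives of \<open>b\<close> and
  \<open>c\<close> in the real direction. The differentials of \<open>b\<close> and \<open>c\<close>
  combine to left multiplication of \<open>B + I * C\<close> by the slice component of
  \<open>h\<close>; the turning of the direction supplies the orthogonal part.\<close>

lemma has_derivative_slice_function:
  assumes q: "q \<notin> \<real>"
    and b: "(b has_derivative (\<lambda>h. Re h *\<^sub>R B - Im h *\<^sub>R C)) (at (slice_coord q))"
    and c: "(c has_derivative (\<lambda>h. Im h *\<^sub>R B + Re h *\<^sub>R C)) (at (slice_coord q))"
  shows "((\<lambda>q. b (slice_coord q) + imag_dir q * c (slice_coord q)) has_derivative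
    slice_diff (imag_dir q) (B + imag_dir q * C) (c (slice_coord q) /\<^sub>R norm (quat_Im q))) (at q)"
proof -
  define I where "I = imag_dir q"
  have I: "I \<in> unit_imag" using imag_dir_unit_imag[OF q] by (simp add: I_def)
  have "((\<lambda>q. b (slice_coord q) + imag_dir q * c (slice_coord q)) has_derivative
    (\<lambda>h. (qRe h *\<^sub>R B - (I \<bullet> h) *\<^sub>R C) + (I * ((I \<bullet> h) *\<^sub>R B + qRe h *\<^sub>R C) +
      ((h - slice_proj I h) /\<^sub>R norm (quat_Im q)) * c (slice_coord q)))) (at q)"
    unfolding I_def
    using has_derivative_compose[OF has_derivative_slice_coord[OF q] b]
      has_derivative_compose[OF has_derivative_slice_coord[OF q] c]
    by (intro has_derivative_add has_derivative_mult has_derivative_imag_dir q) simp_all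
  moreover have "(qRe h *\<^sub>R B - (I \<bullet> h) *\<^sub>R C) + (I * ((I \<bullet> h) *\<^sub>R B + qRe h *\<^sub>R C) +
      ((h - slice_proj I h) /\<^sub>R norm (quat_Im q)) * c (slice_coord q)) =
      slice_diff I (B + I * C) (c (slice_coord q) /\<^sub>R norm (quat_Im q)) h" for h
  proof -
    have "slice_proj I h * (B + I * C) =
        (qRe h *\<^sub>R B - (I \<bullet> h) *\<^sub>R C) + I * ((I \<bullet> h) *\<^sub>R B + qRe h *\<^sub>R C)"
      using unit_imagD(5)[OF I]
      by (simp add: slice_proj_def of_real_def distrib_left distrib_right mult.assoc)
    then show ?thesis by (simp add: slice_diff_def)
  qed
  ultimately show ?thesis by (simp add: I_def)
qed

lemma C_k_on_Complex:
  assumes U: "open U" and "C_k_on k f U" "C_k_on k g U"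
  shows "C_k_on k (\<lambda>x. Complex (f x) (g x)) U"
proof -
  have "C_k_on k (\<lambda>x. of_real (f x) + \<i> * of_real (g x)) U"
    by (intro C_k_on_add C_k_on_mult C_k_on_const C_k_on_linear_comp[OF U bounded_linear_of_real] assms)
  then show ?thesis by (simp add: Complex_eq)
qed

lemma C_k_on_slice_proj:
  assumes U: "open U" and "C_k_on k I U" "C_k_on k h U"
  shows "C_k_on k (\<lambda>x. slice_proj (I x) (h x)) U"
  unfolding slice_proj_def
  by (intro C_k_on_add C_k_on_scaleR C_k_on_inner assms C_k_on_linear_comp[OF U bounded_linear_of_real]
      C_k_on_linear_comp[OF U bounded_linear_quat_sel(1)])

lemma C_k_on_slice_diff:
  assumes "open U" "C_k_on k I U" "C_k_on k A U" "C_k_on k C U" "C_k_on k h U"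
  shows "C_k_on k (\<lambda>x. slice_diff (I x) (A x) (C x) (h x)) U"
  unfolding slice_diff_def by (intro C_k_on_add C_k_on_mult C_k_on_diff C_k_on_slice_proj assms)

lemma C_k_on_slice_diff_inv:
  assumes "open U" "C_k_on k I U" "C_k_on k A U" "C_k_on k C U" "C_k_on k v U"
    and "\<And>x. x \<in> U \<Longrightarrow> C x \<noteq> 0" "\<And>x. x \<in> U \<Longrightarrow> slice_proj (I x) (A x * inverse (C x)) \<noteq> 0"
  shows "C_k_on k (\<lambda>x. slice_diff_inv (I x) (A x) (C x) (v x)) U"
  unfolding slice_diff_inv_def Let_def
  by (intro C_k_on_add C_k_on_mult C_k_on_diff C_k_on_slice_proj C_k_on_inverse assms) auto

lemma C_k_on_norm_quat_Im:
  assumes U: "open U" "U \<inter> \<real> = {}"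
  shows "C_k_on k (\<lambda>q. norm (quat_Im q)) U"
  by (rule C_k_on_norm[OF U(1) C_k_on_linear[OF bounded_linear_quat_Im]])
     (use U in \<open>auto simp: quat_Im_eq_0_iff\<close>)

lemma C_k_on_slice_coord:
  assumes U: "open U" "U \<inter> \<real> = {}"
  shows "C_k_on k slice_coord U"
  unfolding slice_coord_def[abs_def]
  by (intro C_k_on_Complex C_k_on_linear bounded_linear_quat_sel C_k_on_norm_quat_Im U)

lemma C_k_on_imag_dir:
  assumes U: "open U" "U \<inter> \<real> = {}"
  shows "C_k_on k imag_dir U"
  unfolding imag_dir_def[abs_def]
  by (intro C_k_on_scaleR C_k_on_inverse C_k_on_norm_quat_Im C_k_on_linear[OF bounded_linear_quat_Im] U)
     (use U in \<open>auto simp: quat_Im_eq_0_iff\<close>)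

text \<open>Stereographic projection of the direction of the imaginary part, from the pole \<open>- \<epsilon> i\<close>
  with \<open>\<epsilon> = \<plusminus>1\<close>. The factor \<open>\<epsilon>\<close> in the imaginary part keeps both charts holomorphic rather than
  antiholomorphic.\<close>

definition sphere_coord :: "real \<Rightarrow> quat \<Rightarrow> complex" where
  "sphere_coord \<epsilon> q = Complex (qJ q) (\<epsilon> * qK q) /\<^sub>R (norm (quat_Im q) + \<epsilon> * qI q)"

text \<open>Inverse stereographic projection: \<open>u = 0\<close> goes to \<open>\<epsilon>\<close>
  i, and the opposite pole is the limit for \<open>u\<close> tending to infinity.\<close>

definition sphere_pt :: "real \<Rightarrow> complex \<Rightarrow> quat" where
  "sphere_pt \<epsilon> u = Quat 0 (\<epsilon> * (1 - (norm u)\<^sup>2)) (2 * Re u) (\<epsilon> * (2 * Im u)) /\<^sub>R (1 + (norm u)\<^sup>2)"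

text \<open>Written as a sum of linear embeddings, so that its derivative and smoothness follow from
  those of the two coordinates.\<close>

definition quat_chart :: "real \<Rightarrow> quat \<Rightarrow> complex^2" where
  "quat_chart \<epsilon> q = axis 1 (slice_coord q) + axis 2 (sphere_coord \<epsilon> q)"

definition quat_chart_inv :: "real \<Rightarrow> complex^2 \<Rightarrow> quat" where
  "quat_chart_inv \<epsilon> w = slice_pt (sphere_pt \<epsilon> (w $ 2)) (Re (w $ 1)) (Im (w $ 1))"

lemma quat_chart_nth [simp]: "quat_chart \<epsilon> q $ 1 = slice_coord q" "quat_chart \<epsilon> q $ 2 = sphere_coord \<epsilon> q"
  by (simp_all add: quat_chart_def axis_def)

lemma norm_quat_Im_squared: "(norm (quat_Im q))\<^sup>2 = (qI q)\<^sup>2 + (qJ q)\<^sup>2 + (qK q)\<^sup>2"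
  by (simp add: power2_norm_eq_inner) (simp add: inner_quat_def power2_eq_square)

lemma sphere_pt_unit_imag:
  assumes \<epsilon>: "\<epsilon> = 1 \<or> \<epsilon> = -1"
  shows "sphere_pt \<epsilon> u \<in> unit_imag"
proof -
  have "\<epsilon>\<^sup>2 = 1" using \<epsilon> by auto
  define s where "s = (norm u)\<^sup>2"
  have s: "s = (Re u)\<^sup>2 + (Im u)\<^sup>2" "1 + s \<noteq> 0"
    unfolding s_def cmod_power2 by (auto simp: add_nonneg_eq_0_iff add.assoc[symmetric])
  have "(\<epsilon> * (1 - s) * t)\<^sup>2 + (2 * Re u * t)\<^sup>2 + (\<epsilon> * (2 * Im u) * t)\<^sup>2 = ((1 + s) * t)\<^sup>2" for t
    using \<open>\<epsilon>\<^sup>2 = 1\<close> unfolding s(1) by algebra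
  from this[of "inverse (1 + s)"] show ?thesis
    using s(2) by (simp add: unit_imag_iff sphere_pt_def s_def[symmetric] mult.commute)
qed

lemma quat_chart_inverse:
  assumes \<epsilon>: "\<epsilon> = 1 \<or> \<epsilon> = -1" and q: "q \<notin> \<real>" "norm (quat_Im q) + \<epsilon> * qI q \<noteq> 0"
  shows "quat_chart_inv \<epsilon> (quat_chart \<epsilon> q) = q"
proof -
  define r m where "r = norm (quat_Im q)" and "m = r + \<epsilon> * qI q"
  define n where "n = (norm (sphere_coord \<epsilon> q))\<^sup>2"
  have r: "r > 0" "m \<noteq> 0" "r\<^sup>2 = (qI q)\<^sup>2 + (qJ q)\<^sup>2 + (qK q)\<^sup>2"
    using q by (simp_all add: r_def m_def quat_Im_eq_0_iff norm_quat_Im_squared)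
  have \<epsilon>2: "\<epsilon>\<^sup>2 = 1" using \<epsilon> by auto
  have "n = ((qJ q)\<^sup>2 + (\<epsilon> * qK q)\<^sup>2) / m\<^sup>2"
    unfolding n_def by (simp add: cmod_power2 sphere_coord_def m_def[unfolded r_def, symmetric]
        power_mult_distrib power_divide field_simps)
  also have "\<dots> = (r - \<epsilon> * qI q) * m / m\<^sup>2"
  proof -
    \<comment> \<open>The sphere equation factors as a difference of squares, one factor being the
      denominator \<open>m\<close> of the projection.\<close>
    have "(qJ q)\<^sup>2 + (\<epsilon> * qK q)\<^sup>2 = (r - \<epsilon> * qI q) * m"
      unfolding m_def using r(3) \<epsilon>2 by algebra
    then show ?thesis by simp
  qed
  finally have n: "n = (r - \<epsilon> * qI q) / m" using r(2) by (simp add: power2_eq_square)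
  have "1 + n = 2 * r / m" and n': "1 - n = 2 * \<epsilon> * qI q / m"
    unfolding n using r(2) by (simp_all add: m_def field_simps)
  then have N: "inverse (1 + n) = m / (2 * r)" by simp
  have "sphere_pt \<epsilon> (sphere_coord \<epsilon> q) = imag_dir q"
    unfolding sphere_pt_def imag_dir_def n_def[symmetric] N n' r_def[symmetric]
    using r(1,2) \<epsilon>
    by (auto simp: quat_eq_iff sphere_coord_def m_def[unfolded r_def, symmetric] field_simps)
  then show ?thesis
    using slice_pt_slice_coord(1)[OF q(1)] by (simp add: quat_chart_inv_def)
qed

lemma quat_chart_inv_inverse:
  assumes \<epsilon>: "\<epsilon> = 1 \<or> \<epsilon> = -1" and w: "Im (w $ 1) > 0"
  defines "q \<equiv> quat_chart_inv \<epsilon> w"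
  shows "quat_chart \<epsilon> q = w" "q \<notin> \<real>" "norm (quat_Im q) + \<epsilon> * qI q \<noteq> 0"
proof -
  define y u where "y = Im (w $ 1)" and "u = w $ 2"
  define s where "s = (norm u)\<^sup>2"
  have s: "1 + s > 0" by (simp add: s_def add_pos_nonneg)
  note S = sphere_pt_unit_imag[OF \<epsilon>, of u]
  have q: "qRe q = Re (w $ 1)" "quat_Im q = y *\<^sub>R sphere_pt \<epsilon> u"
    using S by (simp_all add: q_def quat_chart_inv_def y_def u_def)
  have r: "norm (quat_Im q) = y" using w by (simp add: q unit_imagD(2)[OF S] y_def)
  have y: "y > 0" using w by (simp add: y_def)
  show "q \<notin> \<real>" using r y quat_Im_eq_0_iff by auto
  have c: "qI q = \<epsilon> * (y * (1 - s) / (1 + s))" "qJ q = y * (2 * Re u) / (1 + s)" "qK q = \<epsilon> * (y * (2 * Im u) / (1 + s))"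
    using arg_cong[OF q(2), of qI] arg_cong[OF q(2), of qJ] arg_cong[OF q(2), of qK]
    by (simp_all add: sphere_pt_def s_def[symmetric] divide_inverse mult_ac)
  have e: "\<epsilon> * (\<epsilon> * x) = x" for x using \<epsilon> by auto
  have m: "norm (quat_Im q) + \<epsilon> * qI q = 2 * y / (1 + s)"
    unfolding r c e using s by (simp add: field_simps)
  then show "norm (quat_Im q) + \<epsilon> * qI q \<noteq> 0" using y s by simp
  have "inverse (2 * y / (1 + s)) * (y * (2 * a) / (1 + s)) = a" for a
  proof -
    have "inverse (2 * y / N) * (y * (2 * a) / N) = a" if "N \<noteq> 0" for N
      using y that by (simp add: field_simps)
    then show ?thesis using s by simp
  qed
  then have "sphere_coord \<epsilon> q = u"
    unfolding sphere_coord_def m unfolding c e by (simp add: complex_eq_iff)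
  moreover have "slice_coord q = w $ 1"
    by (simp add: slice_coord_def q(1) r y_def complex_eq_iff)
  ultimately show "quat_chart \<epsilon> q = w"
    by (simp add: vec_eq_iff forall_2 u_def)
qed

lemma bounded_linear_axis_complex: "bounded_linear (axis k :: complex \<Rightarrow> complex^'n)"
  by (auto intro!: linearI simp: linear_conv_bounded_linear[symmetric] vec_eq_iff axis_def)

text \<open>The quotient rule, rewritten by taking the imaginary part of \<open>q\<close> as a
  multiple of \<open>I\<close>. All dependence on the distance to the real axis is thereby collected
  in one real factor, which does not affect complex linearity.\<close>

lemma has_derivative_sphere_coord:
  fixes q :: quat and \<epsilon> :: real
  defines "I \<equiv> imag_dir q" and "m \<equiv> norm (quat_Im q) + \<epsilon> * qI q"
  assumes q: "q \<notin> \<real>" "m \<noteq> 0"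
  shows "(sphere_coord \<epsilon> has_derivative (\<lambda>h. ((1 + \<epsilon> * qI I) *\<^sub>R Complex (qJ h) (\<epsilon> * qK h) -
      (I \<bullet> h + \<epsilon> * qI h) *\<^sub>R Complex (qJ I) (\<epsilon> * qK I)) /\<^sub>R (m * (1 + \<epsilon> * qI I)))) (at q)"
    and "1 + \<epsilon> * qI I \<noteq> 0"
proof -
  define r where "r = norm (quat_Im q)"
  have r: "r > 0" using q by (simp add: r_def quat_Im_eq_0_iff)
  have c: "qI q = r * qI I" "qJ q = r * qJ I" "qK q = r * qK I"
    using r by (simp_all add: I_def imag_dir_def r_def[symmetric])
  have m: "m = r * (1 + \<epsilon> * qI I)" by (simp add: m_def c(1) r_def[symmetric] algebra_simps)
  then show nz: "1 + \<epsilon> * qI I \<noteq> 0" using q(2) by auto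
  have dm: "((\<lambda>q. norm (quat_Im q) + \<epsilon> * qI q) has_derivative (\<lambda>h. I \<bullet> h + \<epsilon> * qI h)) (at q)"
    unfolding I_def
    by (intro has_derivative_add has_derivative_norm_quat_Im q has_derivative_mult_right
        bounded_linear_imp_has_derivative bounded_linear_quat_sel)
  have db: "((\<lambda>q. Complex (qJ q) (\<epsilon> * qK q)) has_derivative (\<lambda>h. Complex (qJ h) (\<epsilon> * qK h))) (at q)"
    by (intro has_derivative_Complex has_derivative_mult_right
        bounded_linear_imp_has_derivative bounded_linear_quat_sel)
  have "(sphere_coord \<epsilon> has_derivative (\<lambda>h. inverse m *\<^sub>R Complex (qJ h) (\<epsilon> * qK h) +
      (- (inverse m * (I \<bullet> h + \<epsilon> * qI h) * inverse m)) *\<^sub>R Complex (qJ q) (\<epsilon> * qK q))) (at q)"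
    unfolding sphere_coord_def[abs_def] m_def
    by (rule has_derivative_scaleR[OF Deriv.has_derivative_inverse[OF _ dm] db])
       (use q in \<open>simp add: m_def\<close>)
  moreover have "inverse m *\<^sub>R Complex (qJ h) (\<epsilon> * qK h) +
      (- (inverse m * (I \<bullet> h + \<epsilon> * qI h) * inverse m)) *\<^sub>R Complex (qJ q) (\<epsilon> * qK q) =
      ((1 + \<epsilon> * qI I) *\<^sub>R Complex (qJ h) (\<epsilon> * qK h) -
      (I \<bullet> h + \<epsilon> * qI h) *\<^sub>R Complex (qJ I) (\<epsilon> * qK I)) /\<^sub>R (m * (1 + \<epsilon> * qI I))" for h
  proof -
    define n where "n = 1 + \<epsilon> * qI I"
    have "inverse (r * n) * x - inverse (r * n) * y * inverse (r * n) * (r * z) =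
        inverse (r * n * n) * (n * x - y * z)" for x y z
      using r nz unfolding n_def[symmetric] by (simp add: field_simps)
    then show ?thesis
      unfolding m n_def[symmetric] c by (simp add: complex_eq_iff mult.left_commute[of \<epsilon> r])
  qed
  ultimately show "(sphere_coord \<epsilon> has_derivative (\<lambda>h. ((1 + \<epsilon> * qI I) *\<^sub>R Complex (qJ h) (\<epsilon> * qK h) -
      (I \<bullet> h + \<epsilon> * qI h) *\<^sub>R Complex (qJ I) (\<epsilon> * qK I)) /\<^sub>R (m * (1 + \<epsilon> * qI I)))) (at q)"
    by simp
qed

text \<open>Off the real axis the quaternions are the product of a half-plane and the sphere of
  imaginary units. Left multiplication by \<open>I\<close> acts as \<open>\<i>\<close> on the first
  factor and as a right-angle rotation of the tangent plane on the second, which the conformal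
  stereographic chart carries to \<open>\<i>\<close>.\<close>

lemma quat_chart_derivative:
  assumes \<epsilon>: "\<epsilon> = 1 \<or> \<epsilon> = -1" and q: "q \<notin> \<real>" "norm (quat_Im q) + \<epsilon> * qI q \<noteq> 0"
  obtains L where "(quat_chart \<epsilon> has_derivative L) (at q)" "\<And>h. L (imag_dir q * h) = \<i> *s L h"
proof -
  define I where "I = imag_dir q"
  have I: "I \<in> unit_imag" using imag_dir_unit_imag[OF q(1)] by (simp add: I_def)
  obtain x y z where Iq: "I = Quat 0 x y z" and xyz: "x\<^sup>2 + y\<^sup>2 + z\<^sup>2 = 1"
    using I unit_imag_iff[of I] by (metis quat.collapse)
  define E where "E = (\<lambda>h. (1 + \<epsilon> * qI I) *\<^sub>R Complex (qJ h) (\<epsilon> * qK h) -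
      (I \<bullet> h + \<epsilon> * qI h) *\<^sub>R Complex (qJ I) (\<epsilon> * qK I))"
  define s where "s = inverse ((norm (quat_Im q) + \<epsilon> * qI q) * (1 + \<epsilon> * qI I))"
  have E: "E (I * h) = \<i> * E h" for h
    unfolding complex_eq_iff
    using \<epsilon> xyz by (elim disjE) (simp_all add: E_def Iq inner_quat_def, (intro conjI; algebra)+)
  have z: "Complex (qRe (I * h)) (I \<bullet> (I * h)) = \<i> * Complex (qRe h) (I \<bullet> h)" for h
    using inner_unit_imag_mult[OF I, of 1 h] unit_imagD(1)[OF I]
    by (simp add: complex_eq_iff inner_quat_def)
  show thesis
  proof
    show "(quat_chart \<epsilon> has_derivative (\<lambda>h. axis 1 (Complex (qRe h) (I \<bullet> h)) + axis 2 (s *\<^sub>R E h))) (at q)"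
      unfolding quat_chart_def[abs_def]
      using has_derivative_slice_coord[OF q(1)] has_derivative_sphere_coord(1)[OF q]
      by (intro has_derivative_add bounded_linear.has_derivative[OF bounded_linear_axis_complex])
         (simp_all add: E_def s_def I_def)
    show "axis 1 (Complex (qRe (imag_dir q * h)) (I \<bullet> (imag_dir q * h))) + axis 2 (s *\<^sub>R E (imag_dir q * h)) =
        \<i> *s (axis 1 (Complex (qRe h) (I \<bullet> h)) + axis 2 (s *\<^sub>R E h))" for h
      unfolding I_def[symmetric] z E by (simp add: vec_eq_iff forall_2 axis_def)
  qed
qed

lemma C_k_on_quat_chart:
  assumes U: "open U" "U \<inter> \<real> = {}" and V: "\<And>q. q \<in> U \<Longrightarrow> norm (quat_Im q) + \<epsilon> * qI q \<noteq> 0"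
  shows "C_k_on k (quat_chart \<epsilon>) U"
  unfolding quat_chart_def[abs_def] sphere_coord_def
  by (intro C_k_on_add C_k_on_linear_comp[OF U(1) bounded_linear_axis_complex] C_k_on_slice_coord
      C_k_on_scaleR C_k_on_inverse C_k_on_norm_quat_Im C_k_on_Complex C_k_on_mult C_k_on_const
      C_k_on_linear bounded_linear_quat_sel U V)

lemma C_k_on_Quat:
  assumes "open U" "C_k_on k a U" "C_k_on k b U" "C_k_on k c U" "C_k_on k d U"
  shows "C_k_on k (\<lambda>x. Quat (a x) (b x) (c x) (d x)) U"
proof -
  have "C_k_on k (\<lambda>x. a x *\<^sub>R Quat 1 0 0 0 + b x *\<^sub>R Quat 0 1 0 0 + c x *\<^sub>R Quat 0 0 1 0 + d x *\<^sub>R Quat 0 0 0 1) U"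
    by (intro C_k_on_add C_k_on_scaleR C_k_on_const assms)
  moreover have "a x *\<^sub>R Quat 1 0 0 0 + b x *\<^sub>R Quat 0 1 0 0 + c x *\<^sub>R Quat 0 0 1 0 + d x *\<^sub>R Quat 0 0 0 1 =
      Quat (a x) (b x) (c x) (d x)" for x
    by (simp add: quat_eq_iff)
  ultimately show ?thesis by simp
qed

lemma C_k_on_quat_chart_inv: "open U \<Longrightarrow> C_k_on k (quat_chart_inv \<epsilon>) U"
proof -
  assume U: "open U"
  have nz: "1 + u \<bullet> u \<noteq> 0" for u :: complex
    using inner_ge_zero[of u] by linarith
  have *: "C_k_on k (\<lambda>w. Re (w $ i)) U" "C_k_on k (\<lambda>w. Im (w $ i)) U" "C_k_on k (\<lambda>w. w $ i) U" for i :: 2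
    by (intro C_k_on_linear bounded_linear_compose[OF bounded_linear_Re]
        bounded_linear_compose[OF bounded_linear_Im] bounded_linear_vec_nth)+
  show ?thesis
    \<comment> \<open>The norm is not smooth at 0, but its square is; it is therefore replaced by
      the inner product.\<close>
    unfolding quat_chart_inv_def[abs_def] slice_pt_def sphere_pt_def power2_norm_eq_inner
    by (intro C_k_on_add C_k_on_scaleR C_k_on_inverse C_k_on_Quat C_k_on_mult C_k_on_diff C_k_on_inner
        C_k_on_const * U nz C_k_on_linear_comp[OF U bounded_linear_of_real])
qed


section \<open>The induced structure\<close>

text \<open>Regularity enters from here on only through these data: a differential of the
  \<open>slice_diff\<close> shape, smooth coefficient fields, and the nonsingularity conditions that
  make the explicit inverse available.\<close>

locale regular_structure =
  fixes f A C :: "quat \<Rightarrow> quat" and U :: "quat set"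
  assumes open_U: "open U" and U_Reals: "U \<inter> \<real> = {}" and inj: "inj_on f U"
    and deriv: "\<And>q. q \<in> U \<Longrightarrow> (f has_derivative slice_diff (imag_dir q) (A q) (C q)) (at q)"
    and smooth: "\<And>k. C_k_on k A U" "\<And>k. C_k_on k C U"
    and C_nz: "\<And>q. q \<in> U \<Longrightarrow> C q \<noteq> 0"
    and nonsing: "\<And>q. q \<in> U \<Longrightarrow> slice_proj (imag_dir q) (A q * inverse (C q)) \<noteq> 0"
begin

abbreviation "g \<equiv> inv_into U f"
abbreviation "R q \<equiv> slice_diff_inv (imag_dir q) (A q) (C q)"

lemma imag_dir_U: "q \<in> U \<Longrightarrow> imag_dir q \<in> unit_imag"
  using imag_dir_unit_imag U_Reals by blast

lemma continuous_f: "continuous_on U f"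
  using deriv has_derivative_continuous continuous_at_imp_continuous_on by metis

lemma open_image: "V \<subseteq> U \<Longrightarrow> open V \<Longrightarrow> open (f ` V)"
  using continuous_f inj by (meson continuous_on_subset inj_on_subset invariance_of_domain)

lemma slice_diff_R:
  assumes "q \<in> U"
  shows "slice_diff (imag_dir q) (A q) (C q) (R q v) = v" "R q (slice_diff (imag_dir q) (A q) (C q) h) = h"
  using slice_diff_inverse[OF imag_dir_U C_nz nonsing] assms by auto

lemma g_f: "q \<in> U \<Longrightarrow> g (f q) = q"
  using inj by simp

lemma g_in_U: "p \<in> f ` U \<Longrightarrow> g p \<in> U"
  by (rule inv_into_into)

lemma deriv_g:
  assumes "p \<in> f ` U"
  shows "(g has_derivative R (g p)) (at p)"
proof -
  obtain q where q: "q \<in> U" "p = f q" using assms by auto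
  have "(g has_derivative R q) (at (f q))"
    by (rule has_derivative_inverse_strong[OF open_U q(1) continuous_f g_f deriv[OF q(1)]])
       (use slice_diff_R[OF q(1)] in auto)
  then show ?thesis using q g_f by simp
qed

lemma C_k_g: "C_k_on k g (f ` U)"
proof (rule C_k_on_local_inverse[OF open_U open_image g_in_U deriv_g])
  show "C_k_on k (\<lambda>q. R q v) U" for k v
    by (intro C_k_on_slice_diff_inv open_U smooth C_k_on_imag_dir U_Reals C_k_on_const C_nz nonsing)
qed (auto simp: open_U)

lemma C_k_f: "C_k_on k f U"
proof -
  have "C_k_on (Suc k) f U"
    by (rule C_k_on_SucI[OF open_U deriv])
       (auto intro!: C_k_on_slice_diff open_U smooth C_k_on_imag_dir U_Reals)
  then show ?thesis by (rule C_k_on_Suc_imp)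
qed

lemma R_imag_mult:
  assumes q: "q \<in> U"
  shows "R q (imag_dir q * v) = imag_dir q * R q v"
proof -
  have "R q (imag_dir q * v) = R q (slice_diff (imag_dir q) (A q) (C q) (imag_dir q * R q v))"
    using slice_diff_R(1)[OF q] by (simp add: slice_diff_imag_mult[OF imag_dir_U[OF q]])
  then show ?thesis by (simp add: slice_diff_R(2)[OF q])
qed

lemma push_forward_eq:
  assumes "p \<in> f ` U"
  shows "push_forward f U slice_structure p v = imag_dir (g p) * v"
proof -
  define q where "q = g p"
  have q: "q \<in> U" using assms g_in_U by (simp add: q_def)
  let ?D = "slice_diff (imag_dir q) (A q) (C q)"
  have D: "frechet_derivative f (at q) = ?D"
    using frechet_derivative_at[OF deriv[OF q]] by simp
  \<comment> \<open>As \<open>?D\<close> commutes with the multiplication, the chosen inverse occurs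
    only in \<open>?D (inv ?D v)\<close>, which surjectivity reduces to \<open>v\<close>.\<close>
  have "surj ?D" using slice_diff_R(1)[OF q] by (metis surjI)
  then have "?D (inv ?D v) = v" by (rule surj_f_inv_f)
  then show ?thesis
    unfolding push_forward_def q_def[symmetric] Let_def D slice_structure_def
    by (simp add: slice_diff_imag_mult[OF imag_dir_U[OF q]])
qed

lemma integrable: "integrable_structure (f ` U) (push_forward f U slice_structure)"
  unfolding integrable_structure_def
proof
  fix p assume p: "p \<in> f ` U"
  define q where "q = g p"
  have q: "q \<in> U" "f q = p" using p by (auto simp: q_def g_in_U f_inv_into_f)
  \<comment> \<open>The poles of the two stereographic projections are antipodal, so at least one of
    them is defined at \<open>q\<close>.\<close>
  have "\<exists>\<epsilon>. (\<epsilon> = 1 \<or> \<epsilon> = -1) \<and> norm (quat_Im q) + \<epsilon> * qI q \<noteq> 0"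
  proof (rule ccontr)
    assume "\<not> ?thesis"
    then have "norm (quat_Im q) + qI q = 0" "norm (quat_Im q) - qI q = 0" by auto
    then have "norm (quat_Im q) = 0" by linarith
    then show False using q U_Reals by (auto simp: quat_Im_eq_0_iff)
  qed
  then obtain \<epsilon> where \<epsilon>: "\<epsilon> = 1 \<or> \<epsilon> = -1" and q\<epsilon>: "norm (quat_Im q) + \<epsilon> * qI q \<noteq> 0" by blast
  define U' where "U' = {q\<in>U. norm (quat_Im q) + \<epsilon> * qI q \<noteq> 0}"
  have U': "U' \<subseteq> U" "U' \<inter> \<real> = {}" "\<And>q. q \<in> U' \<Longrightarrow> norm (quat_Im q) + \<epsilon> * qI q \<noteq> 0"
    using U_Reals by (auto simp: U'_def)
  have "continuous_on UNIV (\<lambda>q. norm (quat_Im q) + \<epsilon> * qI q)"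
    by (intro continuous_intros linear_continuous_on bounded_linear_quat_Im bounded_linear_quat_sel)
  then have "open ((\<lambda>q. norm (quat_Im q) + \<epsilon> * qI q) -` (- {0}))"
    by (intro open_vimage) (auto simp: open_Compl)
  moreover have "U' = U \<inter> (\<lambda>q. norm (quat_Im q) + \<epsilon> * qI q) -` (- {0})" by (auto simp: U'_def)
  ultimately have open_U': "open U'" using open_U by auto
  define V where "V = f ` U'"
  have open_V: "open V" unfolding V_def by (rule open_image[OF U'(1) open_U'])
  have V: "V \<subseteq> f ` U" "\<And>x. x \<in> V \<Longrightarrow> g x \<in> U'" "\<And>x. x \<in> V \<Longrightarrow> f (g x) = x"
    using U'(1) g_f by (auto simp: V_def)
  \<comment> \<open>This is the image of \<open>U'\<close> under the chart, described as a preimage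
    under the inverse chart so that openness follows from continuity.\<close>
  define W where "W = {w. Im (w $ 1) > 0} \<inter> quat_chart_inv \<epsilon> -` U"
  have "open {w :: complex^2. Im (w $ 1) > 0}"
    by (intro open_Collect_less continuous_intros)
  moreover have cont: "continuous_on UNIV (quat_chart_inv \<epsilon>)"
    using C_k_on_quat_chart_inv[OF open_UNIV, of 0 \<epsilon>] by simp
  ultimately have open_W: "open W"
    unfolding W_def using open_U by (intro open_Int open_vimage) auto
  have W: "quat_chart_inv \<epsilon> w \<in> U'" "quat_chart \<epsilon> (quat_chart_inv \<epsilon> w) = w" if "w \<in> W" for w
    using quat_chart_inv_inverse[OF \<epsilon>, of w] that by (auto simp: W_def U'_def)
  have chart: "quat_chart \<epsilon> x \<in> W" "quat_chart_inv \<epsilon> (quat_chart \<epsilon> x) = x" if "x \<in> U'" for x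
  proof -
    have x: "x \<notin> \<real>" "x \<in> U" using that U' by auto
    show inv: "quat_chart_inv \<epsilon> (quat_chart \<epsilon> x) = x"
      using quat_chart_inverse[OF \<epsilon> x(1) U'(3)[OF that]] .
    show "quat_chart \<epsilon> x \<in> W"
      using inv x slice_pt_slice_coord(2)[OF x(1)] by (simp add: W_def)
  qed
  define \<phi> \<psi> where "\<phi> = (\<lambda>x. quat_chart \<epsilon> (g x))" and "\<psi> = (\<lambda>w. f (quat_chart_inv \<epsilon> w))"
  have \<phi>: "C_k_on k \<phi> V" for k
    unfolding \<phi>_def
    by (rule C_k_on_compose[OF open_V open_U' _ C_k_on_quat_chart[OF open_U' U'(2,3)]
          C_k_on_subset[OF C_k_g V(1)]]) (use V(2) in auto)
  have \<psi>: "C_k_on k \<psi> W" for k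
    unfolding \<psi>_def
    by (rule C_k_on_compose[OF open_W open_U _ C_k_f C_k_on_quat_chart_inv[OF open_W]])
       (use W(1) U'(1) in auto)
  have homeo: "homeomorphism V W \<phi> \<psi>"
  proof (rule homeomorphismI)
    show "continuous_on V \<phi>" "continuous_on W \<psi>"
      using \<phi>[of 0] \<psi>[of 0] by simp_all
    show "\<phi> ` V \<subseteq> W" using V chart by (auto simp: \<phi>_def)
    show "\<psi> ` W \<subseteq> V" using W by (auto simp: \<psi>_def V_def)
    show "\<psi> (\<phi> x) = x" if "x \<in> V" for x using that V chart by (simp add: \<phi>_def \<psi>_def)
    show "\<phi> (\<psi> w) = w" if "w \<in> W" for w
      using W[OF that] U'(1) g_f[of "quat_chart_inv \<epsilon> w"] by (auto simp: \<phi>_def \<psi>_def)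
  qed
  have hol: "frechet_derivative \<phi> (at x) (push_forward f U slice_structure x v) =
      \<i> *s frechet_derivative \<phi> (at x) v"
    if x: "x \<in> V" for x v
  proof -
    have gx: "g x \<in> U'" "g x \<in> U" "g x \<notin> \<real>" using V(2)[OF x] U'(1,2) by auto
    obtain L where L: "(quat_chart \<epsilon> has_derivative L) (at (g x))"
      "\<And>h. L (imag_dir (g x) * h) = \<i> *s L h"
      using quat_chart_derivative[OF \<epsilon> gx(3) U'(3)[OF gx(1)]] by blast
    have "(\<phi> has_derivative (\<lambda>h. L (R (g x) h))) (at x)"
      unfolding \<phi>_def using V(1) x by (intro has_derivative_compose[OF deriv_g L(1)]) auto
    then have "frechet_derivative \<phi> (at x) = (\<lambda>h. L (R (g x) h))"
      using frechet_derivative_at by metis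
    moreover have "push_forward f U slice_structure x v = imag_dir (g x) * v"
      using push_forward_eq V(1) x by blast
    ultimately show ?thesis by (simp add: R_imag_mult[OF gx(2)] L(2))
  qed
  have "p \<in> V" using q q\<epsilon> by (auto simp: V_def U'_def)
  with open_V V(1) open_W homeo \<phi> \<psi> hol
  show "\<exists>V W. \<exists>\<phi> :: quat \<Rightarrow> complex^2. \<exists>\<psi>.
        open V \<and> p \<in> V \<and> V \<subseteq> f ` U \<and> open W \<and>
        homeomorphism V W \<phi> \<psi> \<and> smooth_map_on \<phi> V \<and> smooth_map_on \<psi> W \<and>
        (\<forall>q\<in>V. \<forall>v. frechet_derivative \<phi> (at q) (push_forward f U slice_structure q v) =
          \<i> *s frechet_derivative \<phi> (at q) v)"
    unfolding smooth_map_on_def by blast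
qed

lemma orthogonal_complex_structure:
  "orthogonal_complex_structure_on (f ` U) (push_forward f U slice_structure)"
proof -
  have I: "imag_dir (g p) \<in> unit_imag" if "p \<in> f ` U" for p
    using that g_in_U imag_dir_U by blast
  have "push_forward f U slice_structure p = (*) (imag_dir (g p))" if "p \<in> f ` U" for p
    using push_forward_eq[OF that] by blast
  moreover have "linear ((*) I)" for I :: quat
    by (simp add: bounded_linear.linear bounded_linear_mult_right)
  ultimately show ?thesis
    unfolding orthogonal_complex_structure_on_def
    using integrable open_image[OF subset_refl open_U] unit_imagD(5)[OF I] inner_unit_imag_mult[OF I]
      positively_oriented_unit_imag_mult[OF I]
    by simp
qed

end

theorem proposition4p2:
  fixes \<Omega> :: "quat set" and f :: "quat \<Rightarrow> quat"
  assumes "symmetric_slice_domain \<Omega>"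
    and "slice_regular_on f \<Omega>"
    and "inj_on f \<Omega>"
  shows "(\<forall>q\<in>\<Omega> - \<real>. \<forall>v. push_forward f (\<Omega> - \<real>) slice_structure (f q) v = imag_dir q * v) \<and>
    orthogonal_complex_structure_on (f ` (\<Omega> - \<real>)) (push_forward f (\<Omega> - \<real>) slice_structure)"
proof -
  obtain D b c where D: "open D" and bc: "holomorphic_stem b c D"
    and D_iff: "\<And>I z. I \<in> unit_imag \<Longrightarrow> slice_pt I (Re z) (Im z) \<in> \<Omega> \<longleftrightarrow> z \<in> D"
    and rep: "\<And>I z. I \<in> unit_imag \<Longrightarrow> z \<in> D \<Longrightarrow> f (slice_pt I (Re z) (Im z)) = b z + I * c z"
    using slice_representation[OF assms(1,2)] by blast
  obtain b' c' where bc': "holomorphic_stem b' c' D"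
    and db: "\<And>z. z \<in> D \<Longrightarrow> (b has_derivative (\<lambda>h. Re h *\<^sub>R b' z - Im h *\<^sub>R c' z)) (at z)"
    and dc: "\<And>z. z \<in> D \<Longrightarrow> (c has_derivative (\<lambda>h. Im h *\<^sub>R b' z + Re h *\<^sub>R c' z)) (at z)"
    and dF: "\<And>v z. z \<in> D \<Longrightarrow>
      ((\<lambda>z. Complex (b z \<bullet> v) (c z \<bullet> v)) has_field_derivative Complex (b' z \<bullet> v) (c' z \<bullet> v)) (at z)"
    using holomorphic_stem_derivative[OF D bc] by blast
  define U where "U = \<Omega> - \<real>"
  have U: "open U" "U \<inter> \<real> = {}"
  proof -
    have "(\<real> :: quat set) = quat_Im -` {0}" by (auto simp: quat_Im_eq_0_iff)
    moreover have "closed (quat_Im -` {0})"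
      by (intro closed_vimage linear_continuous_on bounded_linear_quat_Im) auto
    ultimately show "open U" using assms(1) by (auto simp: U_def symmetric_slice_domain_def)
  qed (auto simp: U_def)
  have coord: "q \<notin> \<real>" "imag_dir q \<in> unit_imag" "slice_coord q \<in> D"
    "f q = b (slice_coord q) + imag_dir q * c (slice_coord q)" if "q \<in> U" for q
  proof -
    show q: "q \<notin> \<real>" "imag_dir q \<in> unit_imag" using that imag_dir_unit_imag by (auto simp: U_def)
    note eq = slice_pt_slice_coord(1)[OF q(1)]
    show D: "slice_coord q \<in> D" using D_iff[OF q(2), of "slice_coord q"] eq that by (simp add: U_def)
    show "f q = b (slice_coord q) + imag_dir q * c (slice_coord q)"
      using rep[OF q(2) D] eq by simp
  qed
  \<comment> \<open>Over all of \<open>D\<close> the pairs \<open>(z, I)\<close> and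
    \<open>(cnj z, - I)\<close> name the same point; in the upper half-plane the pair is unique, so
    injectivity of \<open>f\<close> becomes injectivity in the pair.\<close>
  define D' where "D' = {z\<in>D. Im z > 0}"
  have D': "open D'" "D' \<subseteq> D"
    using open_Int[OF D open_halfspace_Im_gt[of 0]] by (auto simp: D'_def Int_def)
  have stem_D': "holomorphic_stem b c D'"
    using bc D'(2) unfolding holomorphic_stem_def by (metis holomorphic_on_subset)
  have inj_D': "z = w \<and> I = J"
    if "z \<in> D'" "w \<in> D'" and IJ: "I \<in> unit_imag" "J \<in> unit_imag" and "b z + I * c z = b w + J * c w" for z w I J
  proof -
    have eq: "slice_pt I (Re z) (Im z) = slice_pt J (Re w) (Im w)"
      using that rep D_iff assms(3) by (auto simp: D'_def inj_on_def)
    have "I = J"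
      using arg_cong[OF eq, of imag_dir] imag_dir_slice_pt that by (simp add: D'_def)
    moreover have "Re z = Re w" using arg_cong[OF eq, of qRe] IJ by simp
    moreover have "Im z = Im w" using arg_cong[OF eq, of quat_Im] IJ \<open>I = J\<close> unit_imagD(4)[OF IJ(1)] by simp
    ultimately show ?thesis by (simp add: complex_eq_iff)
  qed
  define A where "A = (\<lambda>q. b' (slice_coord q) + imag_dir q * c' (slice_coord q))"
  define C where "C = (\<lambda>q. c (slice_coord q) /\<^sub>R norm (quat_Im q))"
  have nonsing: "C q \<noteq> 0" "slice_proj (imag_dir q) (A q * inverse (C q)) \<noteq> 0" if q: "q \<in> U" for q
  proof -
    have z: "slice_coord q \<in> D'"
      using coord[OF q] slice_pt_slice_coord(2) by (simp add: D'_def)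
    have dF': "((\<lambda>z. Complex (b z \<bullet> v) (c z \<bullet> v)) has_field_derivative Complex (b' z \<bullet> v) (c' z \<bullet> v)) (at z)"
      if "z \<in> D'" for v z using dF that D'(2) by blast
    have "c (slice_coord q) \<noteq> 0"
      by (rule stem_nonsingular(1)[OF D'(1) stem_D' dF' _ z coord(2)[OF q]]) (assumption, fact inj_D')
    then show "C q \<noteq> 0"
      using coord(1)[OF q] by (simp add: C_def quat_Im_eq_0_iff)
    have "slice_proj (imag_dir q) (A q * inverse (c (slice_coord q))) \<noteq> 0"
      unfolding A_def
      by (rule stem_nonsingular(2)[OF D'(1) stem_D' dF' _ z coord(2)[OF q]]) (assumption, fact inj_D')
    \<comment> \<open>The spherical derivative differs from \<open>c\<close> by a positive real
      factor, so the nonsingularity condition is the same for both.\<close>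
    moreover have "A q * inverse (C q) = norm (quat_Im q) *\<^sub>R (A q * inverse (c (slice_coord q)))"
      by (simp add: C_def inverse_scaleR_distrib)
    ultimately show "slice_proj (imag_dir q) (A q * inverse (C q)) \<noteq> 0"
      using coord(1)[OF q] by (simp add: slice_proj_scaleR quat_Im_eq_0_iff)
  qed
  have C_k_comp: "C_k_on k (\<lambda>q. F (slice_coord q)) U" if "C_k_on k F D" for k and F :: "complex \<Rightarrow> quat"
    using coord(3) by (intro C_k_on_compose[OF U(1) D _ that] C_k_on_slice_coord U) auto
  interpret regular_structure f A C U
  proof
    show "(f has_derivative slice_diff (imag_dir q) (A q) (C q)) (at q)" if q: "q \<in> U" for q
      unfolding A_def C_def
      by (rule has_derivative_transform_within_open[OF
            has_derivative_slice_function[OF coord(1)[OF q] db[OF coord(3)[OF q]] dc[OF coord(3)[OF q]]] U(1) q])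
         (simp add: coord(4))
    show "C_k_on k A U" "C_k_on k C U" for k
      unfolding A_def C_def
      by (intro C_k_on_add C_k_on_mult C_k_on_scaleR C_k_on_inverse C_k_on_norm_quat_Im C_k_on_imag_dir
          C_k_comp holomorphic_stem_C_k_on[OF D bc] holomorphic_stem_C_k_on[OF D bc'] U;
          use coord in \<open>simp add: quat_Im_eq_0_iff\<close>)+
    show "inj_on f U" using assms(3) by (auto simp: U_def inj_on_def)
  qed (use U nonsing in auto)
  show ?thesis
    using push_forward_eq orthogonal_complex_structure g_f by (simp flip: U_def)
qed

end
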